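(* In the finite setting described in the context, the following hold. (i) Each $J_\sigma$ ($\sigma\in\Sigma$) is $C^2$ in a neighbourhood of $\Theta$; $J=\min_{\sigma\in\Sigma}J_\sigma$ on $\Theta$; and for every $\theta\in\Theta$, $S_0(\theta)\neq\emptyset$ and $S_0(\theta)\subseteq\Sigma^*(\theta):=\{\sigma\in\Sigma:J_\sigma(\theta)=J(\theta)\}$. (ii) For every $\theta\in\Theta$ and every $r\in\mathbb R^{d_\theta}$ with $\theta+hr\in\Theta$ for all small $h>0$, $$D_\theta^+J(\theta)[r]=\min_{\sigma\in\Sigma^*(\theta)}\langle\nabla_\theta J_\sigma(\theta),r\rangle,$$ and for directions feasible on both sides ($\theta+hr\in\Theta$ for all small $|h|$), $$D_\theta^-J(\theta)[r]=\max_{\sigma\in\Sigma^*(\theta)}\langle\nabla_\theta J_\sigma(\theta),r\rangle.$$ Here $\nabla_\theta J_\sigma(\theta)=\mathbb E^{\pi^\theta,\sigma}\big[\sum_{t=0}^{T-1}Q_t^{\sigma,\theta}(X_t,a_t)\nabla_\theta\log\pi_t^\theta(X_t,a_t)\big]$. (iii) For every $\sigma\in\Sigma$ and $\theta\in\Theta$, $$J_\sigma(\theta)-J(\theta)=\mathbb E^{\pi^\theta,\sigma}\Big[\sum_{t=0}^{T-1}g_t^{\sigma,\theta}(X_t,a_t)\Big].$$ In particular, for every $\zeta\ge0$, $J_\sigma(\theta)\le J(\theta)+T\zeta$ for every $\sigma\in S_\zeta(\theta)$. (iv) There are constants $C_0,C_1,C_2$, depending only on the model data and $B$, such that: all $J_\sigma$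 and $J$ are $C_0$-Lipschitz on $\Theta$ for $\|\cdot\|_\infty$; $|g_t^{\sigma,\theta}(x,a)-g_t^{\sigma,\theta'}(x,a)|\le C_1\|\theta-\theta'\|_\infty$ for all $\sigma\in\Sigma$, $(t,x,a)\in\mathcal T\times\mathcal X\times A$, $\theta,\theta'\in\Theta$; and $|J_\sigma(\theta+hr)-J_\sigma(\theta)-h\langle\nabla_\theta J_\sigma(\theta),r\rangle|\le C_2h^2$ for all $\sigma\in\Sigma$, $\|r\|_\infty\le1$ and $\theta,\theta+hr\in\Theta$.
   Context: $\mathcal X\subset\mathbb R^d$, $A\subset\mathbb R^m$ nonempty finite; $T\ge1$ an integer; $\mathcal T=\{0,\dots,T-1\}$; $q\ge1$ an integer; $\varepsilon>0$; $W_q$ the $q$-Wasserstein distance on $\mathcal P(\mathcal X)$ for the Euclidean metric; rewards $f:\mathcal T\times\mathcal X\times A\times\mathcal X\to\mathbb R$, $g:\mathcal X\to\mathbb R$; nominal laws $\mathbb P_t^0(x,a,\cdot)\in\mathcal P(\mathcal X)$; initial law $\mu_0\in\mathcal P(\mathcal X)$; $\mathbb B_t(x,a)=\{\mathbb P:W_q(\mathbb P,\mathbb P_t^0(x,a,\cdot))\le\varepsilon\}$. $\Theta=[-B,B]^{d_\theta}$ with $B>0$; $\pi_t^\theta(x,\cdot)$ is a probability mass function on $A$, and each $\pi_t^\theta(x,a)$ is strictly positive and $C^2$ in $\theta$ near $\Theta$. Write $\langle\mathbb P,\phi\rangle=\sum_{y\in\mathcal X}\mathbb P(\{y\})\phi(y)$.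 Robust values: $V_T^\theta=g$, $G_t^\theta(x,a)=\min_{\mathbb P\in\mathbb B_t(x,a)}\langle\mathbb P,f(t,x,a,\cdot)+V_{t+1}^\theta\rangle$, $V_t^\theta(x)=\sum_a\pi_t^\theta(x,a)G_t^\theta(x,a)$, and $J(\theta)=\sum_x\mu_0(\{x\})V_0^\theta(x)$ (equivalently the worst-case expected total reward of $\pi^\theta$ over transition kernels with values in the balls $\mathbb B_t(x,a)$). Selections: each ball $\mathbb B_t(x,a)$ is a polytope, with finite vertex set $\mathcal V_t(x,a)$. $\Sigma=\prod_{(t,x,a)\in\mathcal T\times\mathcal X\times A}\mathcal V_t(x,a)$ is the finite set of maps $\sigma$ with $\sigma(t,x,a)\in\mathcal V_t(x,a)$. For $\sigma\in\Sigma$, $V_t^{\sigma,\theta}$ and $Q_t^{\sigma,\theta}$ are the state and state-action value functions of $\pi^\theta$ in the non-robust MDP with transition kernels $\sigma(t,x,a)$ (so $V_T^{\sigma,\theta}=g$, $Q_t^{\sigma,\theta}(x,a)=\langle\sigma(t,x,a),f(t,x,a,\cdot)+V_{t+1}^{\sigma,\theta}\rangle$, $V_t^{\sigma,\theta}(x)=\sum_a\pi_t^\theta(x,a)Q_t^{\sigma,\theta}(x,a)$), and $J_\sigma(\theta)=\sum_x\mu_0(\{x\})V_0^{\sigma,\theta}(x)$. $\mathbb E^{\pi^\theta,\sigma}$ is expectation under the path law of $(\mu_0,\pi^\theta,\sigma)$: $X_0\sim\mu_0$, $a_t\sim\pi_t^\theta(X_t,\cdot)$, $X_{t+1}\sim\sigma(t,X_t,a_t)$.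 Gaps and active selections: $g_t^{\sigma,\theta}(x,a)=\langle\sigma(t,x,a),f(t,x,a,\cdot)+V_{t+1}^\theta\rangle-G_t^\theta(x,a)\ge0$ and, for $\zeta\ge0$, $S_\zeta(\theta)=\{\sigma\in\Sigma:g_t^{\sigma,\theta}(x,a)\le\zeta\ \ \forall(t,x,a)\in\mathcal T\times\mathcal X\times A\}$. $D_\theta^+\phi(\theta)[r]=\lim_{h\downarrow0}(\phi(\theta+hr)-\phi(\theta))/h$, $D_\theta^-\phi(\theta)[r]=\lim_{h\uparrow0}(\phi(\theta+hr)-\phi(\theta))/h$. *)

theory Defs
  imports "HOL-Probability.Probability"
begin

section \<open>Calculus\<close>

text \<open>Only meaningful at points where the function is differentiable.\<close>

definition grad :: "('a::real_inner \<Rightarrow> real) \<Rightarrow> 'a \<Rightarrow> 'a" where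
  "grad \<phi> \<theta> = (THE D. GDERIV \<phi> \<theta> :> D)"

text \<open>Intended for open \<open>U\<close>; \<open>G\<close> and \<open>H\<close> are the gradient and the Hessian of \<open>\<phi>\<close>.\<close>

definition C2_on :: "(real^'n) set \<Rightarrow> (real^'n \<Rightarrow> real) \<Rightarrow> bool" where
  "C2_on U \<phi> \<longleftrightarrow> (\<exists>(G :: real^'n \<Rightarrow> real^'n) (H :: real^'n \<Rightarrow> real^'n^'n).
     (\<forall>\<theta>\<in>U. GDERIV \<phi> \<theta> :> G \<theta>) \<and>
     (\<forall>\<theta>\<in>U. (G has_derivative (\<lambda>h. H \<theta> *v h)) (at \<theta>)) \<and>
     continuous_on U H)"


section \<open>Wasserstein distance\<close>

definition couplings :: "'a pmf \<Rightarrow> 'a pmf \<Rightarrow> ('a \<times> 'a) pmf set" where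
  "couplings P Q = {\<gamma>. map_pmf fst \<gamma> = P \<and> map_pmf snd \<gamma> = Q}"

text \<open>Used for finitely supported laws only, so the expectations below are finite sums.\<close>

definition wasserstein :: "nat \<Rightarrow> ('a::metric_space) pmf \<Rightarrow> 'a pmf \<Rightarrow> real" where
  "wasserstein q P Q =
     root q (INF \<gamma>\<in>couplings P Q. measure_pmf.expectation \<gamma> (\<lambda>(y, z). dist y z ^ q))"


section \<open>The model\<close>

text \<open>
  Laws on the finite state space are represented by probability mass functions on \<open>real^'d\<close>
  supported in \<open>states M\<close>. The functions in the record are total; their values outside
  the index sets (times below \<open>horizon M\<close>, states, actions, parameters near the box)
  play no role.
\<close>

record ('d::finite, 'm::finite, 'n::finite) rmdp =
  states :: "(real^'d) set"
  actions :: "(real^'m) set"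
  horizon :: nat
  reward :: "nat \<Rightarrow> real^'d \<Rightarrow> real^'m \<Rightarrow> real^'d \<Rightarrow> real"
  terminal :: "real^'d \<Rightarrow> real"
  nominal :: "nat \<Rightarrow> real^'d \<Rightarrow> real^'m \<Rightarrow> (real^'d) pmf"
  initial :: "(real^'d) pmf"
  wexp :: nat
  radius :: real
  bound :: real
  policy :: "nat \<Rightarrow> real^'n \<Rightarrow> real^'d \<Rightarrow> (real^'m) pmf"

definition Theta :: "('d::finite, 'm::finite, 'n::finite) rmdp \<Rightarrow> (real^'n) set" where
  "Theta M = {\<theta>. \<forall>i. - bound M \<le> \<theta> $ i \<and> \<theta> $ i \<le> bound M}"

locale robust_mdp =
  fixes M :: "('d::finite, 'm::finite, 'n::finite) rmdp"
  assumes finite_states: "finite (states M)" and states_nonempty: "states M \<noteq> {}"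
    and finite_actions: "finite (actions M)" and actions_nonempty: "actions M \<noteq> {}"
    and horizon_ge_1: "horizon M \<ge> 1"
    and wexp_ge_1: "wexp M \<ge> 1"
    and radius_pos: "radius M > 0"
    and bound_pos: "bound M > 0"
    and nominal_states: "\<And>t x a. t < horizon M \<Longrightarrow> x \<in> states M \<Longrightarrow> a \<in> actions M \<Longrightarrow>
          set_pmf (nominal M t x a) \<subseteq> states M"
    and initial_states: "set_pmf (initial M) \<subseteq> states M"
    and policy_actions: "\<And>t \<theta> x. t < horizon M \<Longrightarrow> \<theta> \<in> Theta M \<Longrightarrow> x \<in> states M \<Longrightarrow>
          set_pmf (policy M t \<theta> x) \<subseteq> actions M"
    and policy_smooth: "\<And>t x a. t < horizon M \<Longrightarrow> x \<in> states M \<Longrightarrow> a \<in> actions M \<Longrightarrow>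
          \<exists>U. open U \<and> Theta M \<subseteq> U \<and> (\<forall>\<theta>\<in>U. pmf (policy M t \<theta> x) a > 0) \<and>
              C2_on U (\<lambda>\<theta>. pmf (policy M t \<theta> x) a)"

definition ball_set ::
  "('d::finite, 'm::finite, 'n::finite) rmdp \<Rightarrow> nat \<Rightarrow> real^'d \<Rightarrow> real^'m \<Rightarrow> (real^'d) pmf set" where
  "ball_set M t x a =
     {P. set_pmf P \<subseteq> states M \<and> wasserstein (wexp M) P (nominal M t x a) \<le> radius M}"

definition pairing ::
  "('d::finite, 'm::finite, 'n::finite) rmdp \<Rightarrow> (real^'d) pmf \<Rightarrow> (real^'d \<Rightarrow> real) \<Rightarrow> real" where
  "pairing M P \<phi> = (\<Sum>y\<in>states M. pmf P y * \<phi> y)"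

text \<open>\<open>step_value M t x a P v\<close> is the pairing of \<open>P\<close> with \<open>f(t, x, a, _) + v\<close>.\<close>

definition step_value ::
  "('d::finite, 'm::finite, 'n::finite) rmdp \<Rightarrow> nat \<Rightarrow> real^'d \<Rightarrow> real^'m \<Rightarrow> (real^'d) pmf \<Rightarrow>
    (real^'d \<Rightarrow> real) \<Rightarrow> real" where
  "step_value M t x a P v = pairing M P (\<lambda>y. reward M t x a y + v y)"


section \<open>Robust values\<close>

text \<open>The infimum below is a minimum, the ball being compact.\<close>

definition robust_step ::
  "('d::finite, 'm::finite, 'n::finite) rmdp \<Rightarrow> nat \<Rightarrow> (real^'d \<Rightarrow> real) \<Rightarrow>
    real^'d \<Rightarrow> real^'m \<Rightarrow> real" where
  "robust_step M t v x a = (INF P\<in>ball_set M t x a. step_value M t x a P v)"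

text \<open>The time index runs backwards from \<open>horizon M\<close>; values at later times are never used.\<close>

function V_rob ::
  "('d::finite, 'm::finite, 'n::finite) rmdp \<Rightarrow> real^'n \<Rightarrow> nat \<Rightarrow> real^'d \<Rightarrow> real" where
  "V_rob M \<theta> t =
     (if t < horizon M
      then (\<lambda>x. \<Sum>a\<in>actions M.
              pmf (policy M t \<theta> x) a * robust_step M t (V_rob M \<theta> (Suc t)) x a)
      else terminal M)"
  by pat_completeness auto
termination
  by (relation "Wellfounded.measure (\<lambda>(M, \<theta>, t). horizon M - t)") auto

declare V_rob.simps [simp del]

definition G_rob ::
  "('d::finite, 'm::finite, 'n::finite) rmdp \<Rightarrow> real^'n \<Rightarrow> nat \<Rightarrow> real^'d \<Rightarrow> real^'m \<Rightarrow> real" where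
  "G_rob M \<theta> t x a = robust_step M t (V_rob M \<theta> (Suc t)) x a"

definition J_rob :: "('d::finite, 'm::finite, 'n::finite) rmdp \<Rightarrow> real^'n \<Rightarrow> real" where
  "J_rob M \<theta> = (\<Sum>x\<in>states M. pmf (initial M) x * V_rob M \<theta> 0 x)"


section \<open>Selections\<close>

text \<open>
  The vertices of a ball are its extreme points. The library's \<open>extreme_point_of\<close> needs a real
  vector space, hence its definition is written out for convex combinations of mass functions.
\<close>

definition vertices ::
  "('d::finite, 'm::finite, 'n::finite) rmdp \<Rightarrow> nat \<Rightarrow> real^'d \<Rightarrow> real^'m \<Rightarrow> (real^'d) pmf set" where
  "vertices M t x a = {P \<in> ball_set M t x a.
     \<not> (\<exists>P1\<in>ball_set M t x a. \<exists>P2\<in>ball_set M t x a. \<exists>u::real.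
          P1 \<noteq> P2 \<and> 0 < u \<and> u < 1 \<and> (\<forall>y. pmf P y = (1 - u) * pmf P1 y + u * pmf P2 y))}"

type_synonym ('d, 'm) selection = "nat \<times> (real^'d) \<times> (real^'m) \<Rightarrow> (real^'d) pmf"

definition triples ::
  "('d::finite, 'm::finite, 'n::finite) rmdp \<Rightarrow> (nat \<times> (real^'d) \<times> (real^'m)) set" where
  "triples M = {..<horizon M} \<times> states M \<times> actions M"

text \<open>
  A ball is a polytope and so has finitely many vertices. The extensional product makes the set
  of selections finite, so that \<open>Min\<close> and \<open>Max\<close> over its nonempty subsets are meaningful.
\<close>

definition selections ::
  "('d::finite, 'm::finite, 'n::finite) rmdp \<Rightarrow> ('d, 'm) selection set" where
  "selections M = (\<Pi>\<^sub>E (t, x, a)\<in>triples M. vertices M t x a)"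

function V_sel ::
  "('d::finite, 'm::finite, 'n::finite) rmdp \<Rightarrow> ('d, 'm) selection \<Rightarrow> real^'n \<Rightarrow> nat \<Rightarrow>
    real^'d \<Rightarrow> real" where
  "V_sel M \<sigma> \<theta> t =
     (if t < horizon M
      then (\<lambda>x. \<Sum>a\<in>actions M.
              pmf (policy M t \<theta> x) a * step_value M t x a (\<sigma> (t, x, a)) (V_sel M \<sigma> \<theta> (Suc t)))
      else terminal M)"
  by pat_completeness auto
termination
  by (relation "Wellfounded.measure (\<lambda>(M, \<sigma>, \<theta>, t). horizon M - t)") auto

declare V_sel.simps [simp del]

definition Q_sel ::
  "('d::finite, 'm::finite, 'n::finite) rmdp \<Rightarrow> ('d, 'm) selection \<Rightarrow> real^'n \<Rightarrow> nat \<Rightarrow>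
    real^'d \<Rightarrow> real^'m \<Rightarrow> real" where
  "Q_sel M \<sigma> \<theta> t x a = step_value M t x a (\<sigma> (t, x, a)) (V_sel M \<sigma> \<theta> (Suc t))"

definition J_sel ::
  "('d::finite, 'm::finite, 'n::finite) rmdp \<Rightarrow> ('d, 'm) selection \<Rightarrow> real^'n \<Rightarrow> real" where
  "J_sel M \<sigma> \<theta> = (\<Sum>x\<in>states M. pmf (initial M) x * V_sel M \<sigma> \<theta> 0 x)"

definition optimal_selections ::
  "('d::finite, 'm::finite, 'n::finite) rmdp \<Rightarrow> real^'n \<Rightarrow> ('d, 'm) selection set" where
  "optimal_selections M \<theta> = {\<sigma> \<in> selections M. J_sel M \<sigma> \<theta> = J_rob M \<theta>}"

text \<open>The gap uses the robust value function at the next time, not that of the selection.\<close>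

definition gap ::
  "('d::finite, 'm::finite, 'n::finite) rmdp \<Rightarrow> ('d, 'm) selection \<Rightarrow> real^'n \<Rightarrow> nat \<Rightarrow>
    real^'d \<Rightarrow> real^'m \<Rightarrow> real" where
  "gap M \<sigma> \<theta> t x a =
     step_value M t x a (\<sigma> (t, x, a)) (V_rob M \<theta> (Suc t)) - G_rob M \<theta> t x a"

definition active_selections ::
  "('d::finite, 'm::finite, 'n::finite) rmdp \<Rightarrow> real \<Rightarrow> real^'n \<Rightarrow> ('d, 'm) selection set" where
  "active_selections M \<zeta> \<theta> =
     {\<sigma> \<in> selections M. \<forall>(t, x, a)\<in>triples M. gap M \<sigma> \<theta> t x a \<le> \<zeta>}"


section \<open>Path law\<close>

text \<open>
  A path up to time \<open>t\<close> is a pair of sequences, the states \<open>X 0, \<dots>, X t\<close> and the actions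
  \<open>\<alpha> 0, \<dots>, \<alpha> (t - 1)\<close>; all later entries are \<open>undefined\<close>.
\<close>

primrec path_law ::
  "('d::finite, 'm::finite, 'n::finite) rmdp \<Rightarrow> ('d, 'm) selection \<Rightarrow> real^'n \<Rightarrow> nat \<Rightarrow>
    ((nat \<Rightarrow> real^'d) \<times> (nat \<Rightarrow> real^'m)) pmf" where
  "path_law M \<sigma> \<theta> 0 =
     map_pmf (\<lambda>x. ((\<lambda>_. undefined)(0 := x), \<lambda>_. undefined)) (initial M)"
| "path_law M \<sigma> \<theta> (Suc t) =
     bind_pmf (path_law M \<sigma> \<theta> t) (\<lambda>(X, \<alpha>).
     bind_pmf (policy M t \<theta> (X t)) (\<lambda>a.
     map_pmf (\<lambda>y. (X(Suc t := y), \<alpha>(t := a))) (\<sigma> (t, X t, a))))"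

definition path_expectation ::
  "('d::finite, 'm::finite, 'n::finite) rmdp \<Rightarrow> ('d, 'm) selection \<Rightarrow> real^'n \<Rightarrow>
    ((nat \<Rightarrow> real^'d) \<Rightarrow> (nat \<Rightarrow> real^'m) \<Rightarrow> 'b) \<Rightarrow>
    'b::{banach, second_countable_topology}" where
  "path_expectation M \<sigma> \<theta> F =
     measure_pmf.expectation (path_law M \<sigma> \<theta> (horizon M)) (\<lambda>(X, \<alpha>). F X \<alpha>)"

end

theory Submission
  imports Defs
begin

text \<open>
  A law lies in the Wasserstein ball iff it is the first marginal of a transport plan to the
  nominal law with cost at most \<open>\<epsilon>\<^sup>q\<close>; the plans form a bounded polyhedron in standard form. A plan
  that is not determined by its support can be moved in two opposite directions until a
  coordinate vanishes, so every plan is a convex combination of the finitely many plans that are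
  determined by their support. Hence each ball has finitely many vertices, and linear functionals
  attain their minimum over it at a vertex. By backward induction the robust value functions are the
  minima of the value functions over the finitely many selections, each of which is a polynomial in
  the policy probabilities and hence \<open>C\<^sup>2\<close>. The one-sided derivatives are then those of a minimum
  of finitely many differentiable functions. The policy gradient and the performance difference
  are both obtained by evaluating an additive path functional through its backward recursion.
\<close>

section \<open>Polyhedra in standard form\<close>

text \<open>The distance to the nominal law is an infimum over couplings and not a linear constraint
  on the law; its sublevel set becomes linear only after lifting to plans, which is why the
  polyhedral argument runs there. The price is that projection does not preserve extreme points: the
  marginal of a basic plan need not be a vertex of the ball. Basic plans therefore give only a
  finite set that generates the ball, enough to bound the vertices, and attainment at a genuine
  vertex needs a separate tie-break among the minimizing generators. A single selection serves all
  times and states because laws are chosen independently over (t, x, a), and a gap compares laws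
  against the robust next value, which is the same for all selections. The derivative formulas range
  over all optimal selections and not just the active ones: by the performance difference,
  optimality forces the gaps to vanish only where the selection's own paths go with positive
  probability, so an optimal selection may have positive gaps elsewhere.\<close>

definition std_polyhedron :: "'i set \<Rightarrow> (('i \<Rightarrow> real) \<times> real) set \<Rightarrow> ('i \<Rightarrow> real) set" where
  "std_polyhedron I E = {g. (\<forall>i\<in>I. 0 \<le> g i) \<and> (\<forall>i. i \<notin> I \<longrightarrow> g i = 0) \<and>
     (\<forall>(\<alpha>, b)\<in>E. (\<Sum>i\<in>I. \<alpha> i * g i) = b)}"

text \<open>These are the basic feasible solutions of linear programming, the extreme points of the
  polyhedron. Uniqueness for a given support replaces linear independence of columns, and it bounds
  their number by the number of supports.\<close>

definition basic_points :: "('i \<Rightarrow> real) set \<Rightarrow> ('i \<Rightarrow> real) set" where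
  "basic_points K = {g\<in>K. \<forall>g'\<in>K. (\<forall>i. g i = 0 \<longrightarrow> g' i = 0) \<longrightarrow> g' = g}"

lemma std_polyhedron_nonneg: "g \<in> std_polyhedron I E \<Longrightarrow> 0 \<le> g i"
  by (cases "i \<in> I") (auto simp: std_polyhedron_def)

lemma std_polyhedron_outside: "g \<in> std_polyhedron I E \<Longrightarrow> i \<notin> I \<Longrightarrow> g i = 0"
  by (simp add: std_polyhedron_def)

lemma std_polyhedron_eqD:
  "g \<in> std_polyhedron I E \<Longrightarrow> (\<alpha>, b) \<in> E \<Longrightarrow> (\<Sum>i\<in>I. \<alpha> i * g i) = b"
  by (auto simp: std_polyhedron_def)

lemma finite_basic_points:
  assumes "finite I"
  shows "finite (basic_points (std_polyhedron I E))"
proof (rule inj_on_finite)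
  let ?s = "\<lambda>g. {i\<in>I. g i \<noteq> (0::real)}"
  show "inj_on ?s (basic_points (std_polyhedron I E))"
  proof (rule inj_onI)
    fix g g' assume g: "g \<in> basic_points (std_polyhedron I E)"
      and g': "g' \<in> basic_points (std_polyhedron I E)" and "?s g = ?s g'"
    have "g' i = 0" if "g i = 0" for i
    proof (cases "i \<in> I")
      case True
      with that \<open>?s g = ?s g'\<close> show ?thesis by blast
    next
      case False
      with g' show ?thesis by (auto simp: basic_points_def std_polyhedron_def)
    qed
    with g g' show "g = g'" by (auto simp: basic_points_def)
  qed
  show "?s ` basic_points (std_polyhedron I E) \<subseteq> Pow I" by auto
  show "finite (Pow I)" using assms by simp
qed

lemma std_polyhedron_equation:
  assumes "g \<in> std_polyhedron I E" "(\<alpha>, b) \<in> E" "\<forall>(\<alpha>, b)\<in>E. (\<Sum>i\<in>I. \<alpha> i * d i) = 0"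
  shows "(\<Sum>i\<in>I. \<alpha> i * (g i + s * d i)) = b"
proof -
  have "(\<Sum>i\<in>I. \<alpha> i * (g i + s * d i)) = (\<Sum>i\<in>I. \<alpha> i * g i) + s * (\<Sum>i\<in>I. \<alpha> i * d i)"
    by (simp add: algebra_simps sum.distrib sum_distrib_left)
  moreover have "(\<Sum>i\<in>I. \<alpha> i * g i) = b" "(\<Sum>i\<in>I. \<alpha> i * d i) = 0"
    using assms by (auto simp: std_polyhedron_def)
  ultimately show ?thesis by simp
qed

text \<open>The ratio test of the simplex method: \<open>s\<close> is the largest step that keeps
  all coordinates nonnegative, and a coordinate attaining the minimal ratio vanishes there. Zero
  coordinates stay zero because \<open>d\<close> vanishes on them, so the support shrinks
  strictly.\<close>

lemma std_polyhedron_walk: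
  assumes I: "finite I" and g: "g \<in> std_polyhedron I E"
    and d: "\<forall>i. g i = 0 \<longrightarrow> d i = 0" and eq: "\<forall>(\<alpha>, b)\<in>E. (\<Sum>i\<in>I. \<alpha> i * d i) = 0"
    and neg: "d j < 0"
  obtains s where "s > 0" "(\<lambda>i. g i + s * d i) \<in> std_polyhedron I E"
    "{i\<in>I. g i + s * d i \<noteq> 0} \<subset> {i\<in>I. g i \<noteq> 0}"
proof -
  let ?N = "{i\<in>I. d i < 0}"
  define s where "s = Min ((\<lambda>i. g i / - d i) ` ?N)"
  have gI: "g i = 0" if "i \<notin> I" for i using std_polyhedron_outside[OF g that] .
  have g0: "g i \<ge> 0" for i using std_polyhedron_nonneg[OF g] .
  have jN: "j \<in> ?N" using neg d[rule_format, of j] gI[of j] by fastforce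
  have "s \<in> (\<lambda>i. g i / - d i) ` ?N"
    unfolding s_def using I jN by (intro Min_in) auto
  then obtain k where k: "k \<in> ?N" "s = g k / - d k" by auto
  have gk: "g k > 0" using k d[rule_format, of k] g0[of k] by (cases "g k = 0") auto
  have s: "s > 0" using k gk by (simp add: divide_pos_neg)
  have le: "s \<le> g i / - d i" if "i \<in> ?N" for i
    unfolding s_def using I that by (intro Min_le) auto
  have nn: "g i + s * d i \<ge> 0" if "i \<in> I" for i
  proof (cases "d i < 0")
    case True
    then have "- d i > 0" by simp
    then have "s * (- d i) \<le> g i" using le[of i] True that pos_le_divide_eq by blast
    then show ?thesis by simp
  next
    case False
    then show ?thesis using s g0[of i] by (simp add: add_nonneg_nonneg)
  qed
  have "(\<Sum>i\<in>I. \<alpha> i * (g i + s * d i)) = b" if "(\<alpha>, b) \<in> E" for \<alpha> b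
    using std_polyhedron_equation[OF g that eq] .
  with nn gI d have "(\<lambda>i. g i + s * d i) \<in> std_polyhedron I E"
    by (auto simp: std_polyhedron_def)
  moreover have "{i\<in>I. g i + s * d i \<noteq> 0} \<subset> {i\<in>I. g i \<noteq> 0}"
  proof
    show "{i\<in>I. g i + s * d i \<noteq> 0} \<subseteq> {i\<in>I. g i \<noteq> 0}" using d by auto
    have "g k + s * d k = 0" using k by auto
    then show "{i\<in>I. g i + s * d i \<noteq> 0} \<noteq> {i\<in>I. g i \<noteq> 0}" using k gk by force
  qed
  ultimately show ?thesis using s that by blast
qed

text \<open>A nonzero direction without negative coordinates would give an unbounded ray inside the
  polyhedron.\<close>

lemma std_polyhedron_direction_neg:
  assumes g: "g \<in> std_polyhedron I E"
    and d: "\<forall>i. g i = 0 \<longrightarrow> d i = 0" and eq: "\<forall>(\<alpha>, b)\<in>E. (\<Sum>i\<in>I. \<alpha> i * d i) = 0"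
    and bdd: "\<forall>g\<in>std_polyhedron I E. \<forall>i\<in>I. g i \<le> B"
    and nz: "d k \<noteq> 0"
  obtains j where "d j < 0"
proof (rule ccontr)
  assume "\<not> thesis"
  then have pos: "d i \<ge> 0" for i using that[of i] by force
  have gI: "g i = 0" if "i \<notin> I" for i using std_polyhedron_outside[OF g that] .
  have kI: "k \<in> I" using gI d nz by blast
  have ray: "(\<lambda>i. g i + s * d i) \<in> std_polyhedron I E" if s: "s \<ge> 0" for s
  proof -
    have "(\<Sum>i\<in>I. \<alpha> i * (g i + s * d i)) = b" if "(\<alpha>, b) \<in> E" for \<alpha> b
      using std_polyhedron_equation[OF g that(1) eq] .
    with gI d pos s g show ?thesis by (auto simp: std_polyhedron_def)
  qed
  have le: "g k + s * d k \<le> B" if "s \<ge> 0" for s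
    using bdd[rule_format, OF ray[OF that] kI] .
  have gk: "0 \<le> g k" using g kI by (auto simp: std_polyhedron_def)
  have "d k > 0" using pos[of k] nz by simp
  \<comment> \<open>This step length lifts coordinate \<open>k\<close> to at least
    \<open>\<bar>B\<bar> + 1\<close>, above the bound \<open>B\<close>.\<close>
  with le[of "(\<bar>B\<bar> + 1) / d k"] gk \<open>d k > 0\<close> show False by (simp add: abs_if split: if_splits)
qed

text \<open>
  A point that is not basic lies strictly between two points of smaller support, obtained by
  walking from it in two opposite directions until a coordinate vanishes.
\<close>

lemma std_polyhedron_induct [consumes 3, case_names basic mix]:
  assumes g: "g \<in> std_polyhedron I E" and I: "finite I"
    and bdd: "\<forall>g\<in>std_polyhedron I E. \<forall>i\<in>I. g i \<le> B"
    and basic: "\<And>g. g \<in> basic_points (std_polyhedron I E) \<Longrightarrow> Q g"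
    and mix: "\<And>g1 g2 u. g1 \<in> std_polyhedron I E \<Longrightarrow> g2 \<in> std_polyhedron I E \<Longrightarrow> Q g1 \<Longrightarrow> Q g2 \<Longrightarrow>
        0 < u \<Longrightarrow> u < 1 \<Longrightarrow> Q (\<lambda>i. (1 - u) * g1 i + u * g2 i)"
  shows "Q g"
  using g
proof (induction "card {i\<in>I. g i \<noteq> 0}" arbitrary: g rule: less_induct)
  case less
  show ?case
  proof (cases "g \<in> basic_points (std_polyhedron I E)")
    case False
    with less.prems obtain g' where g': "g' \<in> std_polyhedron I E" "\<And>i. g i = 0 \<Longrightarrow> g' i = 0" "g' \<noteq> g"
      by (auto simp: basic_points_def)
    \<comment> \<open>The difference of two solutions solves the homogeneous equations, and its
      support lies in that of \<open>g\<close>; hence both \<open>d\<close> and \<open>- d\<close>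
      are admissible directions.\<close>
    define d where "d i = g' i - g i" for i
    have d: "\<forall>i. g i = 0 \<longrightarrow> d i = 0" using g' by (simp add: d_def)
    have *: "(\<Sum>i\<in>I. \<alpha> i * d i) = 0" if "(\<alpha>, b) \<in> E" for \<alpha> b
    proof -
      have "(\<Sum>i\<in>I. \<alpha> i * d i) = (\<Sum>i\<in>I. \<alpha> i * g' i) - (\<Sum>i\<in>I. \<alpha> i * g i)"
        by (simp add: d_def algebra_simps sum_subtractf)
      with that g'(1) less.prems show ?thesis by (auto simp: std_polyhedron_def)
    qed
    then have eq: "\<forall>(\<alpha>, b)\<in>E. (\<Sum>i\<in>I. \<alpha> i * d i) = 0" by blast
    have d': "\<forall>i. g i = 0 \<longrightarrow> - d i = 0" using d by simp
    have eq': "\<forall>(\<alpha>, b)\<in>E. (\<Sum>i\<in>I. \<alpha> i * - d i) = 0" using * by (auto simp: sum_negf)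
    obtain k where k: "d k \<noteq> 0" using g'(3) by (auto simp: d_def fun_eq_iff)
    obtain j where j: "d j < 0"
      by (rule std_polyhedron_direction_neg[OF less.prems d eq bdd k])
    have k': "- d k \<noteq> 0" using k by simp
    obtain j' where j': "- d j' < 0"
      by (rule std_polyhedron_direction_neg[OF less.prems d' eq' bdd k'])
    obtain s1 where s1: "s1 > 0" "(\<lambda>i. g i + s1 * d i) \<in> std_polyhedron I E"
      "{i\<in>I. g i + s1 * d i \<noteq> 0} \<subset> {i\<in>I. g i \<noteq> 0}"
      by (rule std_polyhedron_walk[OF I less.prems d eq j])
    obtain s2 where s2: "s2 > 0" "(\<lambda>i. g i + s2 * - d i) \<in> std_polyhedron I E"
      "{i\<in>I. g i + s2 * - d i \<noteq> 0} \<subset> {i\<in>I. g i \<noteq> 0}"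
      by (rule std_polyhedron_walk[OF I less.prems d' eq' j'])
    have fin: "finite {i\<in>I. g i \<noteq> 0}" using I by simp
    have Q1: "Q (\<lambda>i. g i + s1 * d i)"
      using less.hyps[OF psubset_card_mono[OF fin s1(3)] s1(2)] .
    have Q2: "Q (\<lambda>i. g i + s2 * - d i)"
      using less.hyps[OF psubset_card_mono[OF fin s2(3)] s2(2)] .
    \<comment> \<open>The weight for which the two opposite displacements, of lengths
      \<open>s1\<close> and \<open>s2\<close>, cancel.\<close>
    define u where "u = s1 / (s1 + s2)"
    have u: "0 < u" "u < 1" using s1 s2 by (auto simp: u_def)
    have us: "(1 - u) * s1 - u * s2 = 0" using s1 s2 by (simp add: u_def field_simps)
    have "(1 - u) * (g i + s1 * d i) + u * (g i + s2 * - d i) = g i" for i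
    proof -
      have "(1 - u) * (g i + s1 * d i) + u * (g i + s2 * - d i)
        = g i + ((1 - u) * s1 - u * s2) * d i" by (simp add: algebra_simps)
      with us show ?thesis by simp
    qed
    then have "(\<lambda>i. (1 - u) * (g i + s1 * d i) + u * (g i + s2 * - d i)) = g" by simp
    with mix[OF s1(2) s2(2) Q1 Q2 u] show ?thesis by simp
  qed (rule basic)
qed

text \<open>Attainment needs no compactness: there are finitely many basic points.\<close>

lemma std_polyhedron_attains_min:
  assumes "std_polyhedron I E \<noteq> {}" and I: "finite I"
    and bdd: "\<forall>g\<in>std_polyhedron I E. \<forall>i\<in>I. g i \<le> B"
  obtains g where "g \<in> std_polyhedron I E"
    "\<And>g'. g' \<in> std_polyhedron I E \<Longrightarrow> (\<Sum>i\<in>I. c i * g i) \<le> (\<Sum>i\<in>I. c i * g' i)"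
proof -
  let ?B = "basic_points (std_polyhedron I E)" and ?l = "\<lambda>g. \<Sum>i\<in>I. c i * g i"
  define m where "m = Min (?l ` ?B)"
  have fin: "finite ?B" using finite_basic_points[OF I] .
  have ge: "m \<le> ?l g" if "g \<in> std_polyhedron I E" for g
    using that I bdd
  proof (induction rule: std_polyhedron_induct)
    case (basic g)
    then show ?case unfolding m_def using fin by (intro Min_le) auto
  next
    case (mix g1 g2 u)
    have "?l (\<lambda>i. (1 - u) * g1 i + u * g2 i) = (1 - u) * ?l g1 + u * ?l g2"
      by (simp add: sum_distrib_left sum.distrib distrib_left mult.left_commute)
    also have "\<dots> \<ge> (1 - u) * m + u * m"
      using mix by (intro add_mono mult_left_mono) auto
    finally show ?case by (simp add: algebra_simps)
  qed
  \<comment> \<open>Applied to the property \<open>False\<close>, the induction shows that a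
    nonempty polyhedron has a basic point.\<close>
  have "False" if "?B = {}"
  proof -
    from assms(1) obtain g where "g \<in> std_polyhedron I E" by blast
    then show False using I bdd that by (induction rule: std_polyhedron_induct) auto
  qed
  then have "m \<in> ?l ` ?B" unfolding m_def using fin by (intro Min_in) auto
  then obtain g where "g \<in> ?B" "m = ?l g" by auto
  with ge show ?thesis by (intro that[of g]) (auto simp: basic_points_def)
qed

section \<open>Transport plans and Wasserstein balls\<close>

lemma ex_pmf_of_weights:
  fixes f :: "'i \<Rightarrow> real"
  assumes "finite I" "\<And>i. 0 \<le> f i" "\<And>i. i \<notin> I \<Longrightarrow> f i = 0" "sum f I = 1"
  obtains p where "\<And>i. pmf p i = f i" "set_pmf p \<subseteq> I"
proof -
  have "(\<integral>\<^sup>+i. ennreal (f i) \<partial>count_space UNIV) = (\<Sum>i\<in>I. ennreal (f i))"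
    using assms by (intro nn_integral_count_space'[where A = I]) auto
  also have "\<dots> = 1" using assms by (simp add: sum_ennreal)
  finally have "pmf (embed_pmf f) i = f i" for i
    using assms by (intro pmf_embed_pmf) auto
  then show ?thesis using assms(3) by (intro that[of "embed_pmf f"]) (auto simp: set_pmf_iff intro: ccontr)
qed

lemma measure_pmf_eq_sum:
  assumes "finite B" "B \<subseteq> A" "\<And>x. x \<in> A \<Longrightarrow> x \<in> set_pmf p \<Longrightarrow> x \<in> B"
  shows "measure_pmf.prob p A = sum (pmf p) B"
proof -
  have "measure_pmf.prob p A = measure_pmf.prob p B"
    using assms by (intro measure_pmf.finite_measure_eq_AE) (auto simp: AE_measure_pmf_iff)
  then show ?thesis using assms(1) by (simp add: measure_measure_pmf_finite)
qed

lemma pmf_marginals: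
  assumes "finite S" "set_pmf \<gamma> \<subseteq> S \<times> S"
  shows "pmf (map_pmf fst \<gamma>) y = (if y \<in> S then \<Sum>z\<in>S. pmf \<gamma> (y, z) else 0)"
    and "pmf (map_pmf snd \<gamma>) z = (if z \<in> S then \<Sum>y\<in>S. pmf \<gamma> (y, z) else 0)"
proof -
  have "pmf (map_pmf fst \<gamma>) y = (\<Sum>p\<in>Pair y ` S. pmf \<gamma> p)" if "y \<in> S"
    unfolding pmf_map using assms by (intro measure_pmf_eq_sum) auto
  moreover have "pmf (map_pmf fst \<gamma>) y = 0" if "y \<notin> S"
    using assms that by (auto simp: pmf_eq_0_set_pmf)
  ultimately show "pmf (map_pmf fst \<gamma>) y = (if y \<in> S then \<Sum>z\<in>S. pmf \<gamma> (y, z) else 0)"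
    by (simp add: sum.reindex inj_on_def)
  have "pmf (map_pmf snd \<gamma>) z = (\<Sum>p\<in>(\<lambda>y. (y, z)) ` S. pmf \<gamma> p)" if "z \<in> S"
    unfolding pmf_map using assms by (intro measure_pmf_eq_sum) auto
  moreover have "pmf (map_pmf snd \<gamma>) z = 0" if "z \<notin> S"
    using assms that by (auto simp: pmf_eq_0_set_pmf)
  ultimately show "pmf (map_pmf snd \<gamma>) z = (if z \<in> S then \<Sum>y\<in>S. pmf \<gamma> (y, z) else 0)"
    by (simp add: sum.reindex inj_on_def)
qed

lemma couplings_support:
  assumes "\<gamma> \<in> couplings P Q" "set_pmf P \<subseteq> S" "set_pmf Q \<subseteq> S"
  shows "set_pmf \<gamma> \<subseteq> S \<times> S"
  using assms by (force simp: couplings_def)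

lemma coupling_cost_eq_sum:
  fixes c :: "'a \<times> 'a \<Rightarrow> real"
  assumes "finite S" "set_pmf \<gamma> \<subseteq> S \<times> S"
  shows "measure_pmf.expectation \<gamma> c = (\<Sum>p\<in>S \<times> S. c p * pmf \<gamma> p)"
  using assms by (intro integral_measure_pmf_real) auto

text \<open>Row sums and column sums. Total mass one is implied by the row sums when
  \<open>P\<close> is supported in \<open>S\<close>.\<close>

definition coupling_equations :: "'a set \<Rightarrow> 'a pmf \<Rightarrow> 'a pmf \<Rightarrow> (('a \<times> 'a \<Rightarrow> real) \<times> real) set" where
  "coupling_equations S P Q =
     (\<lambda>x. (\<lambda>(y, z). if y = x then 1 else 0, pmf P x)) ` S \<union>
     (\<lambda>x. (\<lambda>(y, z). if z = x then 1 else 0, pmf Q x)) ` S"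

lemma sum_row:
  fixes g :: "'a \<times> 'a \<Rightarrow> real"
  assumes "finite S" "x \<in> S"
  shows "(\<Sum>p\<in>S \<times> S. (case p of (y, z) \<Rightarrow> if y = x then 1 else 0) * g p) = (\<Sum>z\<in>S. g (x, z))"
proof -
  have "(\<Sum>p\<in>S \<times> S. (case p of (y, z) \<Rightarrow> if y = x then 1 else 0) * g p) = (\<Sum>p\<in>Pair x ` S. g p)"
    using assms by (intro sum.mono_neutral_cong_right) auto
  then show ?thesis by (simp add: sum.reindex inj_on_def)
qed

lemma sum_column:
  fixes g :: "'a \<times> 'a \<Rightarrow> real"
  assumes "finite S" "x \<in> S"
  shows "(\<Sum>p\<in>S \<times> S. (case p of (y, z) \<Rightarrow> if z = x then 1 else 0) * g p) = (\<Sum>y\<in>S. g (y, x))"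
proof -
  have "(\<Sum>p\<in>S \<times> S. (case p of (y, z) \<Rightarrow> if z = x then 1 else 0) * g p) = (\<Sum>p\<in>(\<lambda>y. (y, x)) ` S. g p)"
    using assms by (intro sum.mono_neutral_cong_right) auto
  then show ?thesis by (simp add: sum.reindex inj_on_def)
qed

lemma std_polyhedron_coupling_equations:
  assumes S: "finite S" and P: "set_pmf P \<subseteq> S" and Q: "set_pmf Q \<subseteq> S"
  shows "std_polyhedron (S \<times> S) (coupling_equations S P Q) = pmf ` couplings P Q"
proof (intro equalityI subsetI)
  fix g assume g: "g \<in> std_polyhedron (S \<times> S) (coupling_equations S P Q)"
  have g0: "g p \<ge> 0" for p using std_polyhedron_nonneg[OF g] .
  have out: "g p = 0" if "p \<notin> S \<times> S" for p using std_polyhedron_outside[OF g that] .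
  have gP: "(\<Sum>z\<in>S. g (x, z)) = pmf P x" and gQ: "(\<Sum>y\<in>S. g (y, x)) = pmf Q x" if "x \<in> S" for x
    using std_polyhedron_eqD[OF g, of "\<lambda>(y, z). if y = x then 1 else 0" "pmf P x"]
      std_polyhedron_eqD[OF g, of "\<lambda>(y, z). if z = x then 1 else 0" "pmf Q x"]
      that sum_row[OF S that, of g] sum_column[OF S that, of g]
    by (auto simp: coupling_equations_def)
  have "sum g (S \<times> S) = (\<Sum>y\<in>S. pmf P y)"
    using gP sum.cartesian_product[of "\<lambda>y z. g (y, z)" S S] by simp
  also have "\<dots> = 1" using S P by (simp add: sum_pmf_eq_1)
  finally obtain \<gamma> where \<gamma>: "\<And>p. pmf \<gamma> p = g p" "set_pmf \<gamma> \<subseteq> S \<times> S"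
    using ex_pmf_of_weights[of "S \<times> S" g] S g0 out by auto
  have "\<gamma> \<in> couplings P Q"
    using P Q gP gQ \<gamma> S unfolding couplings_def
    by (auto intro!: pmf_eqI simp: pmf_marginals[OF S \<gamma>(2)] pmf_eq_0_set_pmf)
  moreover have "g = pmf \<gamma>" using \<gamma> by auto
  ultimately show "g \<in> pmf ` couplings P Q" by blast
next
  fix g assume "g \<in> pmf ` couplings P Q"
  then obtain \<gamma> where \<gamma>: "\<gamma> \<in> couplings P Q" "g = pmf \<gamma>" by blast
  have supp: "set_pmf \<gamma> \<subseteq> S \<times> S" using couplings_support[OF \<gamma>(1) P Q] .
  have P': "(\<Sum>z\<in>S. pmf \<gamma> (x, z)) = pmf P x" if "x \<in> S" for x
    using pmf_marginals(1)[OF S supp, of x] \<gamma>(1) that by (simp add: couplings_def)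
  have Q': "(\<Sum>y\<in>S. pmf \<gamma> (y, x)) = pmf Q x" if "x \<in> S" for x
    using pmf_marginals(2)[OF S supp, of x] \<gamma>(1) that by (simp add: couplings_def)
  show "g \<in> std_polyhedron (S \<times> S) (coupling_equations S P Q)"
    using supp \<gamma>(2) P' Q' sum_row[OF S] sum_column[OF S]
    by (auto simp: std_polyhedron_def coupling_equations_def pmf_eq_0_set_pmf)
qed

lemma pair_pmf_in_couplings: "pair_pmf P Q \<in> couplings P Q"
  by (simp add: couplings_def map_fst_pair_pmf map_snd_pair_pmf)

text \<open>The infimum over couplings is attained, since they form a bounded polyhedron, nonempty
  because of the product coupling, and the cost is linear. Attainment is what turns an infimum below
  the threshold into an actual plan below it.\<close>

lemma wasserstein_le_iff:
  assumes S: "finite S" and P: "set_pmf P \<subseteq> S" and Q: "set_pmf Q \<subseteq> S" and "q \<ge> 1" "\<epsilon> \<ge> 0"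
  shows "wasserstein q P Q \<le> \<epsilon> \<longleftrightarrow>
    (\<exists>\<gamma>\<in>couplings P Q. (\<Sum>(y, z)\<in>S \<times> S. dist y z ^ q * pmf \<gamma> (y, z)) \<le> \<epsilon> ^ q)"
proof -
  let ?c = "\<lambda>(y, z). dist y z ^ q :: real"
  let ?E = "\<lambda>\<gamma>. measure_pmf.expectation \<gamma> ?c" and ?K = "std_polyhedron (S \<times> S) (coupling_equations S P Q)"
  have K: "?K = pmf ` couplings P Q" by (rule std_polyhedron_coupling_equations[OF S P Q])
  then have "?K \<noteq> {}" using pair_pmf_in_couplings[of P Q] by blast
  moreover have "\<forall>g\<in>?K. \<forall>i\<in>S \<times> S. g i \<le> 1" unfolding K by (auto simp: pmf_le_1)
  ultimately obtain g where g: "g \<in> ?K"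
    "\<And>g'. g' \<in> ?K \<Longrightarrow> (\<Sum>i\<in>S \<times> S. ?c i * g i) \<le> (\<Sum>i\<in>S \<times> S. ?c i * g' i)"
    using S by (elim std_polyhedron_attains_min[where c = ?c]) auto
  then obtain \<gamma> where \<gamma>: "\<gamma> \<in> couplings P Q" "g = pmf \<gamma>" unfolding K by blast
  have cost: "?E \<gamma>' = (\<Sum>i\<in>S \<times> S. ?c i * pmf \<gamma>' i)" if "\<gamma>' \<in> couplings P Q" for \<gamma>'
    using coupling_cost_eq_sum[OF S couplings_support[OF that P Q]] by auto
  have le: "?E \<gamma> \<le> ?E \<gamma>'" if "\<gamma>' \<in> couplings P Q" for \<gamma>'
    using g(2)[of "pmf \<gamma>'"] that \<gamma> K cost by auto
  have inf: "(INF \<gamma>\<in>couplings P Q. ?E \<gamma>) = ?E \<gamma>"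
    using \<gamma>(1) le by (intro cInf_eq_minimum) auto
  have "?E \<gamma> \<ge> 0" by (intro integral_nonneg_AE AE_I2) auto
  \<comment> \<open>The \<open>q\<close>-th root is strictly increasing for
    \<open>q \<ge> 1\<close>, and \<open>\<epsilon>\<close> is the root of its own power because it
    is nonnegative.\<close>
  have "root q (?E \<gamma>) \<le> \<epsilon> \<longleftrightarrow> root q (?E \<gamma>) \<le> root q (\<epsilon> ^ q)"
    using assms by (simp add: real_root_power_cancel)
  also have "\<dots> \<longleftrightarrow> ?E \<gamma> \<le> \<epsilon> ^ q" using assms by simp
  finally have "wasserstein q P Q \<le> \<epsilon> \<longleftrightarrow> ?E \<gamma> \<le> \<epsilon> ^ q"
    by (simp add: wasserstein_def inf)
  also have "\<dots> \<longleftrightarrow> (\<exists>\<gamma>\<in>couplings P Q. ?E \<gamma> \<le> \<epsilon> ^ q)"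
    using le \<gamma>(1) order_trans by blast
  finally show ?thesis using cost by (auto simp: case_prod_unfold)
qed

text \<open>The slack of the cost constraint is the coordinate \<open>None\<close>.\<close>

definition transport_equations ::
  "'a set \<Rightarrow> 'a pmf \<Rightarrow> ('a \<times> 'a \<Rightarrow> real) \<Rightarrow> real \<Rightarrow> ((('a \<times> 'a) option \<Rightarrow> real) \<times> real) set" where
  "transport_equations S Q c b =
     (\<lambda>x. (case_option 0 (\<lambda>(y, z). if z = x then 1 else 0), pmf Q x)) ` S \<union> {(case_option 1 c, b)}"

text \<open>Only the second marginal is prescribed. The row sums stay free, so that one polyhedron
  carries the plans of all laws in the ball.\<close>

definition transport_polyhedron ::
  "'a set \<Rightarrow> 'a pmf \<Rightarrow> ('a \<times> 'a \<Rightarrow> real) \<Rightarrow> real \<Rightarrow> (('a \<times> 'a) option \<Rightarrow> real) set" where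
  "transport_polyhedron S Q c b =
     std_polyhedron (insert None (Some ` (S \<times> S))) (transport_equations S Q c b)"

lemma sum_insert_None:
  fixes h :: "'a option \<Rightarrow> real"
  assumes "finite A"
  shows "sum h (insert None (Some ` A)) = h None + (\<Sum>p\<in>A. h (Some p))"
  using assms by (subst sum.insert) (auto simp: sum.reindex)

text \<open>The column sums add up to the mass of \<open>Q\<close>, hence the \<open>Some\<close>
  coordinates form a mass function; the cost equation identifies the slack with the unspent
  budget.\<close>

lemma transport_polyhedronD:
  assumes S: "finite S" and Q: "set_pmf Q \<subseteq> S" and g: "g \<in> transport_polyhedron S Q c b"
  obtains \<gamma> where "set_pmf \<gamma> \<subseteq> S \<times> S" "map_pmf snd \<gamma> = Q" "\<And>p. g (Some p) = pmf \<gamma> p"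
    "g None = b - (\<Sum>p\<in>S \<times> S. c p * pmf \<gamma> p)"
proof -
  have SS: "finite (S \<times> S)" using S by simp
  have g0: "g i \<ge> 0" for i using std_polyhedron_nonneg[OF g[unfolded transport_polyhedron_def]] .
  have out: "g (Some p) = 0" if "p \<notin> S \<times> S" for p
    using std_polyhedron_outside[OF g[unfolded transport_polyhedron_def], of "Some p"] that by auto
  have gQ: "(\<Sum>y\<in>S. g (Some (y, x))) = pmf Q x" if "x \<in> S" for x
  proof -
    have "(\<Sum>i\<in>insert None (Some ` (S \<times> S)).
        case_option 0 (\<lambda>(y, z). if z = x then 1 else 0) i * g i) = pmf Q x"
      using that by (intro std_polyhedron_eqD[OF g[unfolded transport_polyhedron_def]])
        (simp add: transport_equations_def)
    then show ?thesis
      using sum_column[OF S that, of "\<lambda>p. g (Some p)"] by (simp add: sum_insert_None[OF SS])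
  qed
  have "(\<Sum>i\<in>insert None (Some ` (S \<times> S)). case_option 1 c i * g i) = b"
    by (intro std_polyhedron_eqD[OF g[unfolded transport_polyhedron_def]])
      (simp add: transport_equations_def)
  then have cost: "g None + (\<Sum>p\<in>S \<times> S. c p * g (Some p)) = b" by (simp add: sum_insert_None[OF SS])
  have "(\<Sum>p\<in>S \<times> S. g (Some p)) = (\<Sum>z\<in>S. \<Sum>y\<in>S. g (Some (y, z)))"
    by (subst sum.swap) (simp add: sum.cartesian_product)
  also have "\<dots> = (\<Sum>z\<in>S. pmf Q z)" using gQ by simp
  also have "\<dots> = 1" using S Q by (simp add: sum_pmf_eq_1)
  finally obtain \<gamma> where \<gamma>: "\<And>p. pmf \<gamma> p = g (Some p)" "set_pmf \<gamma> \<subseteq> S \<times> S"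
    using ex_pmf_of_weights[of "S \<times> S" "\<lambda>p. g (Some p)"] S g0 out by auto
  have "map_pmf snd \<gamma> = Q"
    using Q gQ \<gamma> S by (auto intro!: pmf_eqI simp: pmf_marginals[OF S \<gamma>(2)] pmf_eq_0_set_pmf)
  then show ?thesis using \<gamma> cost by (intro that[of \<gamma>]) auto
qed

lemma transport_polyhedronI:
  assumes S: "finite S" and \<gamma>: "set_pmf \<gamma> \<subseteq> S \<times> S" "map_pmf snd \<gamma> = Q"
    and b: "(\<Sum>p\<in>S \<times> S. c p * pmf \<gamma> p) \<le> b"
  shows "case_option (b - (\<Sum>p\<in>S \<times> S. c p * pmf \<gamma> p)) (pmf \<gamma>) \<in> transport_polyhedron S Q c b"
proof -
  have SS: "finite (S \<times> S)" using S by simp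
  have "(\<Sum>y\<in>S. pmf \<gamma> (y, x)) = pmf Q x" if "x \<in> S" for x
    using pmf_marginals(2)[OF S \<gamma>(1), of x] \<gamma>(2) that by simp
  then show ?thesis
    using \<gamma>(1) b sum_column[OF S]
    by (auto simp: transport_polyhedron_def std_polyhedron_def transport_equations_def
      sum_insert_None[OF SS] pmf_eq_0_set_pmf split: option.splits)
qed

text \<open>
  Every member of \<open>W\<close> is a convex combination of members of \<open>F\<close>, stated as an induction
  principle because mass functions do not form a vector space.
\<close>

definition convex_generators :: "'a pmf set \<Rightarrow> 'a pmf set \<Rightarrow> bool" where
  "convex_generators F W \<longleftrightarrow> F \<subseteq> W \<and>
     (\<forall>R. (\<forall>P\<in>F. R P) \<and>
       (\<forall>P1\<in>W. \<forall>P2\<in>W. \<forall>u P. R P1 \<and> R P2 \<and> 0 < u \<and> u < 1 \<and>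
          (\<forall>y. pmf P y = (1 - u) * pmf P1 y + u * pmf P2 y) \<longrightarrow> R P) \<longrightarrow> (\<forall>P\<in>W. R P))"

lemma convex_generators_induct:
  assumes "convex_generators F W" "P \<in> W" "\<And>P. P \<in> F \<Longrightarrow> R P"
    "\<And>P P1 P2 u. P1 \<in> W \<Longrightarrow> P2 \<in> W \<Longrightarrow> R P1 \<Longrightarrow> R P2 \<Longrightarrow> 0 < u \<Longrightarrow> u < 1 \<Longrightarrow>
      \<forall>y. pmf P y = (1 - u) * pmf P1 y + u * pmf P2 y \<Longrightarrow> R P"
  shows "R P"
proof -
  have "\<forall>P1\<in>W. \<forall>P2\<in>W. \<forall>u P. R P1 \<and> R P2 \<and> 0 < u \<and> u < 1 \<and>
      (\<forall>y. pmf P y = (1 - u) * pmf P1 y + u * pmf P2 y) \<longrightarrow> R P"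
    by (intro ballI allI impI, elim conjE) (rule assms(4))
  moreover have "\<forall>P\<in>F. R P" using assms(3) by blast
  ultimately show ?thesis
    using assms(1,2) unfolding convex_generators_def by blast
qed

text \<open>The generators are the first marginals of the basic transport plans.\<close>

lemma wasserstein_ball_generators:
  fixes Q :: "'a::metric_space pmf"
  assumes S: "finite S" and Q: "set_pmf Q \<subseteq> S" and q: "q \<ge> 1" and \<epsilon>: "\<epsilon> \<ge> 0"
  defines "W \<equiv> {P. set_pmf P \<subseteq> S \<and> wasserstein q P Q \<le> \<epsilon>}"
  obtains F where "finite F" "convex_generators F W"
proof -
  define c :: "'a \<times> 'a \<Rightarrow> real" where "c = (\<lambda>(y, z). dist y z ^ q)"
  define I where "I = insert None (Some ` (S \<times> S))"
  define E where "E = transport_equations S Q c (\<epsilon> ^ q)"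
  define proj :: "(('a \<times> 'a) option \<Rightarrow> real) \<Rightarrow> 'a \<Rightarrow> real"
    \<comment> \<open>The first marginal as a linear map on plans; linearity carries mixtures of
      plans to mixtures of laws.\<close>
    where "proj g y = (if y \<in> S then \<Sum>z\<in>S. g (Some (y, z)) else 0)" for g y
  define F where "F = {P\<in>W. pmf P \<in> proj ` basic_points (std_polyhedron I E)}"
  have K: "std_polyhedron I E = transport_polyhedron S Q c (\<epsilon> ^ q)"
    by (simp add: I_def E_def transport_polyhedron_def)
  have I: "finite I" using S by (simp add: I_def)
  have W: "P \<in> W \<longleftrightarrow> set_pmf P \<subseteq> S \<and> (\<exists>\<gamma>\<in>couplings P Q. (\<Sum>p\<in>S \<times> S. c p * pmf \<gamma> p) \<le> \<epsilon> ^ q)" for P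
    using wasserstein_le_iff[OF S _ Q q \<epsilon>, of P] by (auto simp: W_def c_def case_prod_unfold)
  \<comment> \<open>The ball is exactly the image of the plan polyhedron under \<open>proj\<close>:
    \<open>down\<close> gives one inclusion, \<open>up\<close> the other.\<close>
  have down: "\<exists>P\<in>W. pmf P = proj g" if g: "g \<in> std_polyhedron I E" for g
  proof -
    obtain \<gamma> where \<gamma>: "set_pmf \<gamma> \<subseteq> S \<times> S" "map_pmf snd \<gamma> = Q" "\<And>p. g (Some p) = pmf \<gamma> p"
      "g None = \<epsilon> ^ q - (\<Sum>p\<in>S \<times> S. c p * pmf \<gamma> p)"
      using transport_polyhedronD[OF S Q g[unfolded K]] by blast
    have "g None \<ge> 0" using std_polyhedron_nonneg[OF g] .
    then have "map_pmf fst \<gamma> \<in> W"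
      unfolding W using \<gamma> by (auto simp: couplings_def intro!: bexI[of _ \<gamma>])
    moreover have "pmf (map_pmf fst \<gamma>) = proj g"
      by (auto simp: fun_eq_iff proj_def pmf_marginals[OF S \<gamma>(1)] \<gamma>(3))
    ultimately show ?thesis by blast
  qed
  have up: "\<exists>g\<in>std_polyhedron I E. pmf P = proj g" if P: "P \<in> W" for P
  proof -
    obtain \<gamma> where \<gamma>: "\<gamma> \<in> couplings P Q" "(\<Sum>p\<in>S \<times> S. c p * pmf \<gamma> p) \<le> \<epsilon> ^ q"
      and "set_pmf P \<subseteq> S" using P W by blast
    then have supp: "set_pmf \<gamma> \<subseteq> S \<times> S" using couplings_support Q by blast
    have "pmf P = proj (case_option (\<epsilon> ^ q - (\<Sum>p\<in>S \<times> S. c p * pmf \<gamma> p)) (pmf \<gamma>))"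
      using \<gamma>(1) pmf_marginals(1)[OF S supp] by (auto simp: fun_eq_iff proj_def couplings_def)
    then show ?thesis
      using transport_polyhedronI[OF S supp _ \<gamma>(2), of Q] \<gamma>(1) K by (auto simp: couplings_def)
  qed
  \<comment> \<open>Masses are at most \<open>1\<close>, and the slack is at most
    \<open>\<epsilon> ^ q\<close> since costs are nonnegative; the sum covers both kinds of
    coordinate.\<close>
  have bdd: "\<forall>g\<in>std_polyhedron I E. \<forall>i\<in>I. g i \<le> 1 + \<epsilon> ^ q"
  proof (intro ballI)
    fix g i assume g: "g \<in> std_polyhedron I E"
    obtain \<gamma> where \<gamma>: "\<And>p. g (Some p) = pmf \<gamma> p" "g None = \<epsilon> ^ q - (\<Sum>p\<in>S \<times> S. c p * pmf \<gamma> p)"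
      using transport_polyhedronD[OF S Q g[unfolded K]] by metis
    have "(\<Sum>p\<in>S \<times> S. c p * pmf \<gamma> p) \<ge> 0" by (intro sum_nonneg) (auto simp: c_def)
    moreover have "\<epsilon> ^ q \<ge> 0" using \<epsilon> by simp
    ultimately show "g i \<le> 1 + \<epsilon> ^ q"
      using \<gamma> by (cases i) (auto intro: order_trans[OF pmf_le_1])
  qed
  have "finite (pmf ` F)"
    by (rule finite_subset[OF _ finite_imageI[OF finite_basic_points[OF I], of proj]]) (auto simp: F_def)
  then have "finite F"
    by (rule finite_imageD) (auto simp: inj_on_def intro: pmf_eqI)
  have conv_R: "\<forall>P\<in>W. R P" if gen: "\<forall>P\<in>F. R P" and
    conv: "\<forall>P1\<in>W. \<forall>P2\<in>W. \<forall>u P. R P1 \<and> R P2 \<and> 0 < u \<and> u < 1 \<and>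
        (\<forall>y. pmf P y = (1 - u) * pmf P1 y + u * pmf P2 y) \<longrightarrow> R P" for R
  proof -
    \<comment> \<open>The induction runs over plans; quantifying over every \<open>P\<close> with
      mass function \<open>proj g\<close> transfers the property to laws without choosing a plan for
      each.\<close>
    have "\<forall>P\<in>W. pmf P = proj g \<longrightarrow> R P" if "g \<in> std_polyhedron I E" for g
      using that I bdd
    proof (induction rule: std_polyhedron_induct)
      case (basic g)
      then show ?case using gen by (auto simp: F_def)
    next
      case (mix g1 g2 u)
      obtain P1 P2 where P12: "P1 \<in> W" "pmf P1 = proj g1" "P2 \<in> W" "pmf P2 = proj g2"
        using mix(1,2) down by blast
      have "proj (\<lambda>i. (1 - u) * g1 i + u * g2 i) y = (1 - u) * proj g1 y + u * proj g2 y" for y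
        by (simp add: proj_def sum.distrib sum_distrib_left)
      then have "pmf P y = (1 - u) * pmf P1 y + u * pmf P2 y"
        if "pmf P = proj (\<lambda>i. (1 - u) * g1 i + u * g2 i)" for P y
        using that P12 by simp
      then show ?case using conv mix.hyps(3,4) mix.IH P12 by blast
    qed
    with up show ?thesis by blast
  qed
  have "F \<subseteq> W" by (auto simp: F_def)
  then have "convex_generators F W"
    unfolding convex_generators_def
    by (intro conjI allI impI, assumption) (elim conjE, rule conv_R)
  with \<open>finite F\<close> show ?thesis by (rule that)
qed

section \<open>Robust values and selections\<close>

lemma step_value_mono:
  assumes "\<And>y. y \<in> states M \<Longrightarrow> v y \<le> w y"
  shows "step_value M t x a P v \<le> step_value M t x a P w"
  unfolding step_value_def pairing_def
  using assms by (intro sum_mono mult_left_mono) auto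

lemma step_value_diff:
  "step_value M t x a P v - step_value M t x a P w = (\<Sum>y\<in>states M. pmf P y * (v y - w y))"
  unfolding step_value_def pairing_def by (simp add: sum_subtractf[symmetric] algebra_simps)

lemma V_rob_step:
  "t < horizon M \<Longrightarrow> V_rob M \<theta> t x = (\<Sum>a\<in>actions M. pmf (policy M t \<theta> x) a * G_rob M \<theta> t x a)"
  by (subst V_rob.simps) (simp add: G_rob_def)

lemma V_rob_horizon: "V_rob M \<theta> (horizon M) = terminal M"
  by (subst V_rob.simps) simp

lemma V_sel_step:
  "t < horizon M \<Longrightarrow>
    V_sel M \<sigma> \<theta> t x = (\<Sum>a\<in>actions M. pmf (policy M t \<theta> x) a * Q_sel M \<sigma> \<theta> t x a)"
  by (subst V_sel.simps) (simp add: Q_sel_def)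

lemma V_sel_horizon: "V_sel M \<sigma> \<theta> (horizon M) = terminal M"
  by (subst V_sel.simps) simp

text \<open>The exact defect in the convexity of the sum of squares: for \<open>0 < u\<close> and
  \<open>u < 1\<close> the subtracted term is positive as soon as the two functions differ somewhere
  on a finite \<open>S\<close>.\<close>

lemma sum_squares_mix:
  fixes p p1 p2 :: "'a \<Rightarrow> real"
  assumes "\<forall>y. p y = (1 - u) * p1 y + u * p2 y"
  shows "(\<Sum>y\<in>S. (p y)\<^sup>2) = (1 - u) * (\<Sum>y\<in>S. (p1 y)\<^sup>2) + u * (\<Sum>y\<in>S. (p2 y)\<^sup>2)
      - u * (1 - u) * (\<Sum>y\<in>S. (p1 y - p2 y)\<^sup>2)"
proof -
  have "(p y)\<^sup>2 = (1 - u) * (p1 y)\<^sup>2 + u * (p2 y)\<^sup>2 - u * (1 - u) * (p1 y - p2 y)\<^sup>2" for y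
    unfolding assms[rule_format] by (simp add: power2_eq_square algebra_simps)
  then have "(\<Sum>y\<in>S. (p y)\<^sup>2)
      = (\<Sum>y\<in>S. (1 - u) * (p1 y)\<^sup>2 + u * (p2 y)\<^sup>2 - u * (1 - u) * (p1 y - p2 y)\<^sup>2)"
    by (rule sum.cong[OF refl])
  then show ?thesis by (simp only: sum.distrib sum_subtractf sum_distrib_left[symmetric])
qed

context robust_mdp
begin

section \<open>Vertices and minimizers of a ball\<close>

lemma ball_generators:
  assumes "t < horizon M" "x \<in> states M" "a \<in> actions M"
  obtains F where "finite F" "convex_generators F (ball_set M t x a)"
  unfolding ball_set_def
  by (rule wasserstein_ball_generators
      [OF finite_states nominal_states[OF assms] wexp_ge_1 less_imp_le[OF radius_pos]])

text \<open>The diagonal coupling has cost zero, a positive exponent making the cost vanish on the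
  diagonal. This is what makes the ball nonempty.\<close>

lemma nominal_in_ball:
  assumes "t < horizon M" "x \<in> states M" "a \<in> actions M"
  shows "nominal M t x a \<in> ball_set M t x a"
proof -
  let ?Q = "nominal M t x a" and ?\<gamma> = "map_pmf (\<lambda>y. (y, y)) (nominal M t x a)"
  note Q = nominal_states[OF assms]
  have "?\<gamma> \<in> couplings ?Q ?Q" by (simp add: couplings_def pmf.map_comp o_def)
  moreover have "dist y z ^ wexp M * pmf ?\<gamma> (y, z) = 0" for y z
  proof (cases "y = z")
    case False
    then have "(y, z) \<notin> set_pmf ?\<gamma>" by auto
    then show ?thesis by (simp add: pmf_eq_0_set_pmf)
  qed (use wexp_ge_1 in simp)
  then have "(\<Sum>(y, z)\<in>states M \<times> states M. dist y z ^ wexp M * pmf ?\<gamma> (y, z)) = 0"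
    by (intro sum.neutral) auto
  then have "(\<Sum>(y, z)\<in>states M \<times> states M. dist y z ^ wexp M * pmf ?\<gamma> (y, z)) \<le> radius M ^ wexp M"
    using radius_pos by simp
  ultimately show ?thesis
    using wasserstein_le_iff[OF finite_states Q Q wexp_ge_1, of "radius M"] radius_pos Q
    by (auto simp: ball_set_def)
qed

text \<open>A vertex can be reached only as a generator: if a proper mixture is a vertex, its two
  parts must coincide with each other and hence with the mixture.\<close>

lemma finite_vertices:
  assumes "t < horizon M" "x \<in> states M" "a \<in> actions M"
  shows "finite (vertices M t x a)"
proof -
  let ?W = "ball_set M t x a"
  obtain F where F: "finite F" "convex_generators F ?W"
    using ball_generators[OF assms] .
  have "P \<in> vertices M t x a \<longrightarrow> P \<in> F" if "P \<in> ?W" for P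
    using F(2) that
  proof (rule convex_generators_induct)
    fix P P1 P2 and u :: real
    assume P: "P1 \<in> ?W" "P2 \<in> ?W" and R: "P1 \<in> vertices M t x a \<longrightarrow> P1 \<in> F"
      and u: "0 < u" "u < 1" and mix: "\<forall>y. pmf P y = (1 - u) * pmf P1 y + u * pmf P2 y"
    show "P \<in> vertices M t x a \<longrightarrow> P \<in> F"
    proof
      assume "P \<in> vertices M t x a"
      with P u mix have "P1 = P2" unfolding vertices_def by blast
      with mix have "P = P1" by (auto intro!: pmf_eqI simp: algebra_simps)
      with \<open>P \<in> vertices M t x a\<close> R show "P \<in> F" by simp
    qed
  qed blast
  then have "vertices M t x a \<subseteq> F" by (auto simp: vertices_def)
  then show ?thesis using F(1) by (rule finite_subset)
qed

text \<open>
  Among the minimizing generators, one with the largest sum of squared masses is a vertex,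
  because the sum of squares is strictly convex.
\<close>

lemma ex_minimizing_vertex:
  assumes "t < horizon M" "x \<in> states M" "a \<in> actions M"
  obtains P where "P \<in> vertices M t x a"
    "\<And>P'. P' \<in> ball_set M t x a \<Longrightarrow> pairing M P \<phi> \<le> pairing M P' \<phi>"
proof -
  let ?W = "ball_set M t x a"
  define l where "l P = pairing M P \<phi>" for P
  define N where "N P = (\<Sum>y\<in>states M. (pmf P y)\<^sup>2)" for P
  obtain F where F: "finite F" and gen: "convex_generators F ?W"
    using ball_generators[OF assms] .
  have "F \<noteq> {}"
    using convex_generators_induct[OF gen nominal_in_ball[OF assms], of "\<lambda>_. False"] by blast
  have l_mix: "l P = (1 - u) * l P1 + u * l P2"
    if "\<forall>y. pmf P y = (1 - u) * pmf P1 y + u * pmf P2 y" for P P1 P2 u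
    unfolding l_def pairing_def
    by (simp only: that[rule_format] distrib_right sum.distrib sum_distrib_left mult.assoc)
  define m where "m = Min (l ` F)"
  have min: "m \<le> l P" if "P \<in> ?W" for P
    using gen that
  proof (rule convex_generators_induct)
    show "m \<le> l P" if "P \<in> F" for P using F that by (simp add: m_def)
    show "m \<le> l P" if "m \<le> l P1" "m \<le> l P2" "0 < u" "u < 1"
      "\<forall>y. pmf P y = (1 - u) * pmf P1 y + u * pmf P2 y" for P P1 P2 u
    proof -
      have "(1 - u) * m + u * m \<le> l P"
        unfolding l_mix[OF that(5)] using that by (intro add_mono mult_left_mono) auto
      then show ?thesis by (simp add: algebra_simps)
    qed
  qed
  \<comment> \<open>Two nonnegative excesses over \<open>m\<close> with positive weights add up to
    zero, so both vanish: the minimizers form a face of the ball.\<close>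
  have both_min: "l P1 = m \<and> l P2 = m"
    if "P1 \<in> ?W" "P2 \<in> ?W" "0 < u" "u < 1" "l P = m"
      "\<forall>y. pmf P y = (1 - u) * pmf P1 y + u * pmf P2 y" for P P1 P2 u
  proof -
    have "(1 - u) * (l P1 - m) + u * (l P2 - m) = 0"
      using that l_mix[OF that(6)] by (simp add: algebra_simps)
    moreover have "(1 - u) * (l P1 - m) \<ge> 0" "u * (l P2 - m) \<ge> 0" using that min by auto
    ultimately have "(1 - u) * (l P1 - m) = 0" "u * (l P2 - m) = 0" by linarith+
    then show ?thesis using that by simp
  qed
  define F' where "F' = {P\<in>F. l P = m}"
  have "m \<in> l ` F" using F \<open>F \<noteq> {}\<close> unfolding m_def by (intro Min_in) auto
  then have F': "finite F'" "F' \<noteq> {}"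
    using F by (auto simp: F'_def)
  define n where "n = Max (N ` F')"
  have "n \<in> N ` F'" using F' unfolding n_def by (intro Max_in) auto
  then obtain P where P: "P \<in> F'" "N P = n" by blast
  have N_le: "N P' \<le> (1 - u) * N P1 + u * N P2"
    if "0 < u" "u < 1" "\<forall>y. pmf P' y = (1 - u) * pmf P1 y + u * pmf P2 y" for P' P1 P2 u
  proof -
    have "u * (1 - u) * (\<Sum>y\<in>states M. (pmf P1 y - pmf P2 y)\<^sup>2) \<ge> 0"
      using that by (intro mult_nonneg_nonneg sum_nonneg) auto
    then show ?thesis unfolding N_def sum_squares_mix[OF that(3)] by simp
  qed
  \<comment> \<open>The maximum over the minimizing generators bounds \<open>N\<close> on all
    minimizers: the parts of a minimizing mixture are minimizing, and \<open>N\<close> is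
    convex.\<close>
  have max: "l P = m \<longrightarrow> N P \<le> n" if "P \<in> ?W" for P
    using gen that
  proof (rule convex_generators_induct)
    show "l P = m \<longrightarrow> N P \<le> n" if "P \<in> F" for P using F' that by (simp add: n_def F'_def)
    fix P P1 P2 and u :: real
    assume W: "P1 \<in> ?W" "P2 \<in> ?W" and N: "l P1 = m \<longrightarrow> N P1 \<le> n" "l P2 = m \<longrightarrow> N P2 \<le> n"
      and u: "0 < u" "u < 1" and mix: "\<forall>y. pmf P y = (1 - u) * pmf P1 y + u * pmf P2 y"
    show "l P = m \<longrightarrow> N P \<le> n"
    proof
      assume "l P = m"
      then have "N P1 \<le> n" "N P2 \<le> n" using both_min[OF W u _ mix] N by auto
      then have "(1 - u) * N P1 + u * N P2 \<le> (1 - u) * n + u * n"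
        using u by (intro add_mono mult_left_mono) auto
      then show "N P \<le> n" using N_le[OF u mix] by (simp add: algebra_simps)
    qed
  qed
  \<comment> \<open>If \<open>P\<close> were a proper mixture, its parts would be distinct
    minimizers, and strict convexity would put one of them above the maximum
    \<open>n\<close>.\<close>
  have "P \<in> vertices M t x a"
  proof (rule ccontr)
    assume "P \<notin> vertices M t x a"
    moreover have "P \<in> F" using P by (simp add: F'_def)
    then have "P \<in> ?W" using gen unfolding convex_generators_def by blast
    ultimately obtain P1 P2 and u :: real where *: "P1 \<in> ?W" "P2 \<in> ?W" "P1 \<noteq> P2" "0 < u" "u < 1"
      "\<forall>y. pmf P y = (1 - u) * pmf P1 y + u * pmf P2 y"
      unfolding vertices_def by blast
    obtain z where z: "pmf P1 z \<noteq> pmf P2 z" using *(3) by (metis pmf_eqI)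
    \<comment> \<open>\<open>N\<close> sees only masses on states; both parts are supported there,
      so the point where they differ is a state.\<close>
    have "z \<in> states M"
    proof (rule ccontr)
      assume "z \<notin> states M"
      then have "pmf P1 z = 0" "pmf P2 z = 0" using *(1,2) by (auto simp: ball_set_def pmf_eq_0_set_pmf)
      with z show False by simp
    qed
    then have "(\<Sum>y\<in>states M. (pmf P1 y - pmf P2 y)\<^sup>2) > 0"
      using z finite_states by (intro sum_pos2[of _ z]) auto
    then have "N P < (1 - u) * N P1 + u * N P2"
      unfolding N_def sum_squares_mix[OF *(6)] using *(4,5) by simp
    moreover have "l P = m" using P by (simp add: F'_def)
    then have "N P1 \<le> n" "N P2 \<le> n"
      using both_min[OF *(1,2,4,5) _ *(6)] max[OF *(1)] max[OF *(2)] by blast+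
    then have "(1 - u) * N P1 + u * N P2 \<le> (1 - u) * n + u * n"
      using * by (intro add_mono mult_left_mono) auto
    ultimately show False using P by (simp add: algebra_simps)
  qed
  with min P show ?thesis by (intro that[of P]) (auto simp: F'_def l_def)
qed

lemma robust_step_attained:
  assumes "t < horizon M" "x \<in> states M" "a \<in> actions M"
  obtains P where "P \<in> vertices M t x a" "robust_step M t v x a = step_value M t x a P v"
    "\<And>P'. P' \<in> ball_set M t x a \<Longrightarrow> step_value M t x a P v \<le> step_value M t x a P' v"
proof -
  obtain P where P: "P \<in> vertices M t x a"
    and le: "\<And>P'. P' \<in> ball_set M t x a \<Longrightarrow> step_value M t x a P v \<le> step_value M t x a P' v"
    using ex_minimizing_vertex[OF assms, of "\<lambda>y. reward M t x a y + v y"]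
    unfolding step_value_def by metis
  have "robust_step M t v x a = step_value M t x a P v"
    unfolding robust_step_def using P le by (intro cInf_eq_minimum) (auto simp: vertices_def)
  then show ?thesis using P le by (intro that)
qed

lemma robust_step_le:
  assumes "t < horizon M" "x \<in> states M" "a \<in> actions M" "P \<in> ball_set M t x a"
  shows "robust_step M t v x a \<le> step_value M t x a P v"
  using robust_step_attained[OF assms(1-3), of v] assms(4) by metis

lemma selection_vertex:
  assumes "\<sigma> \<in> selections M" "t < horizon M" "x \<in> states M" "a \<in> actions M"
  shows "\<sigma> (t, x, a) \<in> vertices M t x a"
  using PiE_mem[OF assms(1)[unfolded selections_def], of "(t, x, a)"] assms by (auto simp: triples_def)

lemma selection_in_ball:
  assumes "\<sigma> \<in> selections M" "t < horizon M" "x \<in> states M" "a \<in> actions M"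
  shows "\<sigma> (t, x, a) \<in> ball_set M t x a"
  using selection_vertex[OF assms] by (simp add: vertices_def)

lemma selection_support:
  assumes "\<sigma> \<in> selections M" "t < horizon M" "x \<in> states M" "a \<in> actions M"
  shows "set_pmf (\<sigma> (t, x, a)) \<subseteq> states M"
  using selection_in_ball[OF assms] by (simp add: ball_set_def)

lemma finite_triples: "finite (triples M)"
  by (simp add: triples_def finite_states finite_actions)

lemma finite_selections: "finite (selections M)"
  unfolding selections_def
  by (intro finite_PiE finite_triples) (auto simp: triples_def finite_vertices)

section \<open>Comparison of robust values with values of selections\<close>

lemma sum_policy:
  assumes "\<theta> \<in> Theta M" "t < horizon M" "x \<in> states M"
  shows "(\<Sum>a\<in>actions M. pmf (policy M t \<theta> x) a) = 1"
  using policy_actions[OF assms(2,1,3)] by (intro sum_pmf_eq_1 finite_actions)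

lemma G_rob_le:
  assumes "\<sigma> \<in> selections M" "t < horizon M" "x \<in> states M" "a \<in> actions M"
  shows "G_rob M \<theta> t x a \<le> step_value M t x a (\<sigma> (t, x, a)) (V_rob M \<theta> (Suc t))"
  unfolding G_rob_def by (rule robust_step_le[OF assms(2-4) selection_in_ball[OF assms]])

text \<open>Every selection takes its laws from the balls, so one step yields at least the robust
  minimum; monotonicity of \<open>step_value\<close> in the next value propagates this backward in
  time.\<close>

lemma V_rob_le_V_sel:
  assumes \<sigma>: "\<sigma> \<in> selections M" and "t \<le> horizon M" "x \<in> states M"
  shows "V_rob M \<theta> t x \<le> V_sel M \<sigma> \<theta> t x"
  using assms(2,3)
proof (induction t arbitrary: x rule: inc_induct)
  case (step t)
  have "G_rob M \<theta> t x a \<le> Q_sel M \<sigma> \<theta> t x a" if "a \<in> actions M" for a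
    unfolding Q_sel_def
    using order_trans[OF G_rob_le[OF \<sigma> step.hyps(2) step.prems that] step_value_mono[OF step.IH]] .
  then show ?case
    by (auto simp: V_rob_step[OF step.hyps(2)] V_sel_step[OF step.hyps(2)] intro!: sum_mono mult_left_mono)
qed (simp add: V_rob_horizon V_sel_horizon)

text \<open>Each remaining stage contributes at most one gap \<zeta>. The accumulated constant
  passes unchanged through the averages over successors and over actions, both having mass one. For
  \<zeta> = 0 this is the converse of \<open>V_rob_le_V_sel\<close>.\<close>

lemma V_sel_le_active:
  assumes \<theta>: "\<theta> \<in> Theta M" and \<sigma>: "\<sigma> \<in> active_selections M \<zeta> \<theta>"
    and "t \<le> horizon M" "x \<in> states M"
  shows "V_sel M \<sigma> \<theta> t x \<le> V_rob M \<theta> t x + real (horizon M - t) * \<zeta>"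
  using assms(3,4)
proof (induction t arbitrary: x rule: inc_induct)
  case (step t)
  note t = step.hyps(2)
  let ?k = "real (horizon M - Suc t)"
  have "\<sigma> \<in> selections M" using \<sigma> by (simp add: active_selections_def)
  have "Q_sel M \<sigma> \<theta> t x a \<le> G_rob M \<theta> t x a + (1 + ?k) * \<zeta>" if a: "a \<in> actions M" for a
  proof -
    let ?P = "\<sigma> (t, x, a)"
    have "Q_sel M \<sigma> \<theta> t x a - step_value M t x a ?P (V_rob M \<theta> (Suc t))
      = (\<Sum>y\<in>states M. pmf ?P y * (V_sel M \<sigma> \<theta> (Suc t) y - V_rob M \<theta> (Suc t) y))"
      unfolding Q_sel_def step_value_diff ..
    also have "\<dots> \<le> (\<Sum>y\<in>states M. pmf ?P y * (?k * \<zeta>))"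
      using step.IH by (intro sum_mono mult_left_mono) (auto simp: algebra_simps)
    also have "\<dots> = ?k * \<zeta>"
      using selection_support[OF \<open>\<sigma> \<in> selections M\<close> t step.prems a]
      by (simp add: sum_distrib_right[symmetric] sum_pmf_eq_1 finite_states)
    finally have "Q_sel M \<sigma> \<theta> t x a \<le> step_value M t x a ?P (V_rob M \<theta> (Suc t)) + ?k * \<zeta>" by simp
    moreover have "gap M \<sigma> \<theta> t x a \<le> \<zeta>"
      using \<sigma> t step.prems a by (auto simp: active_selections_def triples_def)
    ultimately show ?thesis by (simp add: gap_def algebra_simps)
  qed
  then have "V_sel M \<sigma> \<theta> t x
      \<le> (\<Sum>a\<in>actions M. pmf (policy M t \<theta> x) a * (G_rob M \<theta> t x a + (1 + ?k) * \<zeta>))"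
    unfolding V_sel_step[OF t] by (intro sum_mono mult_left_mono) auto
  also have "\<dots> = V_rob M \<theta> t x + (\<Sum>a\<in>actions M. pmf (policy M t \<theta> x) a) * ((1 + ?k) * \<zeta>)"
    unfolding V_rob_step[OF t] by (simp only: sum_distrib_right sum.distrib distrib_left)
  also have "1 + ?k = real (horizon M - t)" using t by simp
  finally show ?case unfolding sum_policy[OF \<theta> t step.prems] by simp
qed (simp add: V_rob_horizon V_sel_horizon)

text \<open>Each triple receives its own minimizing vertex. The choices do not interfere because all
  are made against the robust next value, which depends on no selection.\<close>

lemma active_selection_exists: "active_selections M 0 \<theta> \<noteq> {}"
proof -
  let ?best = "\<lambda>t x a P. P \<in> vertices M t x a \<and>
    robust_step M t (V_rob M \<theta> (Suc t)) x a = step_value M t x a P (V_rob M \<theta> (Suc t))"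
  \<comment> \<open>\<open>restrict\<close> supplies the default value outside the triples that
    membership in the extensional product demands.\<close>
  define \<sigma> where "\<sigma> = restrict (\<lambda>(t, x, a). SOME P. ?best t x a P) (triples M)"
  have best: "?best t x a (\<sigma> (t, x, a))" if "(t, x, a) \<in> triples M" for t x a
  proof -
    have "t < horizon M" "x \<in> states M" "a \<in> actions M" using that by (auto simp: triples_def)
    then have "\<exists>P. ?best t x a P" using robust_step_attained by metis
    from someI_ex[OF this] that show ?thesis by (simp add: \<sigma>_def)
  qed
  then have "\<sigma> \<in> selections M" unfolding selections_def by (auto simp: \<sigma>_def PiE_def)
  with best have "\<sigma> \<in> active_selections M 0 \<theta>"
    by (auto simp: active_selections_def gap_def G_rob_def)
  then show ?thesis by blast
qed

lemma V_sel_eq_active: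
  assumes "\<theta> \<in> Theta M" "\<sigma> \<in> active_selections M 0 \<theta>" "t \<le> horizon M" "x \<in> states M"
  shows "V_sel M \<sigma> \<theta> t x = V_rob M \<theta> t x"
  using V_sel_le_active[OF assms] V_rob_le_V_sel[of \<sigma> t x \<theta>] assms
  by (auto simp: active_selections_def)

lemma selections_nonempty: "selections M \<noteq> {}"
  using active_selection_exists by (auto simp: active_selections_def)

text \<open>One active selection attains the minimum at all times and states at once. Robust values
  at intermediate times become minima of smooth functions, which later bounds the variation of the
  gaps.\<close>

lemma V_rob_eq_Min:
  assumes "\<theta> \<in> Theta M" "t \<le> horizon M" "x \<in> states M"
  shows "V_rob M \<theta> t x = Min ((\<lambda>\<sigma>. V_sel M \<sigma> \<theta> t x) ` selections M)"
proof (rule Min_eqI[symmetric])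
  obtain \<sigma> where \<sigma>: "\<sigma> \<in> active_selections M 0 \<theta>" using active_selection_exists by blast
  then show "V_rob M \<theta> t x \<in> (\<lambda>\<sigma>. V_sel M \<sigma> \<theta> t x) ` selections M"
    using V_sel_eq_active[OF assms(1) \<sigma> assms(2,3)]
    by (intro image_eqI[of _ _ \<sigma>]) (auto simp: active_selections_def)
qed (use V_rob_le_V_sel assms finite_selections in auto)

lemma G_rob_eq_Min:
  assumes \<theta>: "\<theta> \<in> Theta M" and t: "t < horizon M" and xa: "x \<in> states M" "a \<in> actions M"
  shows "G_rob M \<theta> t x a = Min ((\<lambda>\<sigma>. Q_sel M \<sigma> \<theta> t x a) ` selections M)"
proof (rule Min_eqI[symmetric])
  obtain \<sigma> where \<sigma>: "\<sigma> \<in> active_selections M 0 \<theta>" using active_selection_exists by blast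
  then have "\<sigma> \<in> selections M" "gap M \<sigma> \<theta> t x a \<le> 0"
    using t xa by (auto simp: active_selections_def triples_def)
  \<comment> \<open>The next values of an active selection are the robust ones, so its
    \<open>Q_sel\<close> exceeds \<open>G_rob\<close> exactly by its gap, which is zero.\<close>
  moreover have "Q_sel M \<sigma> \<theta> t x a = step_value M t x a (\<sigma> (t, x, a)) (V_rob M \<theta> (Suc t))"
    unfolding Q_sel_def step_value_def pairing_def
    using V_sel_eq_active[OF \<theta> \<sigma>, of "Suc t"] t by (intro sum.cong) auto
  ultimately have "G_rob M \<theta> t x a = Q_sel M \<sigma> \<theta> t x a"
    using G_rob_le[OF _ t xa, of \<sigma> \<theta>] by (auto simp: gap_def)
  with \<open>\<sigma> \<in> selections M\<close> show "G_rob M \<theta> t x a \<in> (\<lambda>\<sigma>. Q_sel M \<sigma> \<theta> t x a) ` selections M" by blast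
next
  fix y assume "y \<in> (\<lambda>\<sigma>. Q_sel M \<sigma> \<theta> t x a) ` selections M"
  then obtain \<sigma> where \<sigma>: "\<sigma> \<in> selections M" "y = Q_sel M \<sigma> \<theta> t x a" by blast
  show "G_rob M \<theta> t x a \<le> y"
    unfolding \<sigma>(2) Q_sel_def
    using t V_rob_le_V_sel[OF \<sigma>(1)] by (intro order_trans[OF G_rob_le[OF \<sigma>(1) t xa]] step_value_mono) auto
qed (use finite_selections in auto)

lemma J_rob_le_J_sel: "\<sigma> \<in> selections M \<Longrightarrow> J_rob M \<theta> \<le> J_sel M \<sigma> \<theta>"
  unfolding J_rob_def J_sel_def using V_rob_le_V_sel by (intro sum_mono mult_left_mono) auto

lemma J_sel_le_active:
  assumes "\<theta> \<in> Theta M" "\<sigma> \<in> active_selections M \<zeta> \<theta>"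
  shows "J_sel M \<sigma> \<theta> \<le> J_rob M \<theta> + real (horizon M) * \<zeta>"
proof -
  have "J_sel M \<sigma> \<theta> \<le> (\<Sum>x\<in>states M. pmf (initial M) x * (V_rob M \<theta> 0 x + real (horizon M) * \<zeta>))"
    unfolding J_sel_def using V_sel_le_active[OF assms, of 0] by (intro sum_mono mult_left_mono) auto
  also have "\<dots> = J_rob M \<theta> + (\<Sum>x\<in>states M. pmf (initial M) x) * (real (horizon M) * \<zeta>)"
    unfolding J_rob_def by (simp only: sum_distrib_right sum.distrib distrib_left)
  finally show ?thesis by (simp add: sum_pmf_eq_1 finite_states initial_states)
qed

lemma active_subset_optimal:
  assumes "\<theta> \<in> Theta M"
  shows "active_selections M 0 \<theta> \<subseteq> optimal_selections M \<theta>"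
proof
  fix \<sigma> assume \<sigma>: "\<sigma> \<in> active_selections M 0 \<theta>"
  then have "\<sigma> \<in> selections M" by (simp add: active_selections_def)
  then show "\<sigma> \<in> optimal_selections M \<theta>"
    using J_sel_le_active[OF assms \<sigma>] J_rob_le_J_sel[of \<sigma> \<theta>] by (simp add: optimal_selections_def)
qed

lemma J_rob_eq_Min:
  assumes "\<theta> \<in> Theta M"
  shows "J_rob M \<theta> = Min ((\<lambda>\<sigma>. J_sel M \<sigma> \<theta>) ` selections M)"
proof (rule Min_eqI[symmetric])
  obtain \<sigma> where "\<sigma> \<in> optimal_selections M \<theta>"
    using active_subset_optimal[OF assms] active_selection_exists[of \<theta>] by blast
  then show "J_rob M \<theta> \<in> (\<lambda>\<sigma>. J_sel M \<sigma> \<theta>) ` selections M"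
    by (intro image_eqI[of _ _ \<sigma>]) (auto simp: optimal_selections_def)
qed (use J_rob_le_J_sel finite_selections in auto)

end

section \<open>Twice differentiable functions and minima of finite families\<close>

lemma GDERIV_unique:
  assumes "GDERIV \<phi> \<theta> :> D" "GDERIV \<phi> \<theta> :> D'"
  shows "D = D'"
proof -
  have "(\<lambda>h. h \<bullet> D) = (\<lambda>h. h \<bullet> D')"
    using assms unfolding gderiv_def by (rule has_derivative_unique)
  then have "h \<bullet> (D - D') = 0" for h by (metis inner_diff_right right_minus_eq)
  then show ?thesis by (metis inner_eq_zero_iff right_minus_eq)
qed

lemma grad_eqI: "GDERIV \<phi> \<theta> :> D \<Longrightarrow> grad \<phi> \<theta> = D"
  unfolding grad_def using GDERIV_unique by blast

lemma GDERIV_sum: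
  assumes "\<And>i. i \<in> I \<Longrightarrow> GDERIV (f i) \<theta> :> D i"
  shows "GDERIV (\<lambda>\<theta>. \<Sum>i\<in>I. f i \<theta>) \<theta> :> (\<Sum>i\<in>I. D i)"
  using assms unfolding gderiv_def inner_sum_right by (rule has_derivative_sum)

lemma GDERIV_line:
  assumes "GDERIV \<phi> \<theta> :> D"
  shows "((\<lambda>h. \<phi> (\<theta> + h *\<^sub>R r)) has_real_derivative D \<bullet> r) (at 0)"
proof -
  have "(\<phi> has_derivative (\<lambda>h. h \<bullet> D)) (at (\<theta> + 0 *\<^sub>R r))"
    using assms by (simp add: gderiv_def)
  moreover have "((\<lambda>h. \<theta> + h *\<^sub>R r) has_derivative (\<lambda>h. h *\<^sub>R r)) (at 0)"
    by (auto intro!: derivative_eq_intros)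
  ultimately have "((\<lambda>h. \<phi> (\<theta> + h *\<^sub>R r)) has_derivative (\<lambda>h. (h *\<^sub>R r) \<bullet> D)) (at 0)"
    by (rule has_derivative_compose[rotated])
  moreover have "(\<lambda>h. (h *\<^sub>R r) \<bullet> D) = (*) (D \<bullet> r)"
    by (simp add: fun_eq_iff inner_commute)
  ultimately show ?thesis
    by (simp add: has_field_derivative_def)
qed

section \<open>Calculus of twice continuously differentiable functions\<close>

lemma C2_on_subset: "C2_on U \<phi> \<Longrightarrow> V \<subseteq> U \<Longrightarrow> C2_on V \<phi>"
  unfolding C2_on_def by (meson continuous_on_subset subsetD)

lemma C2_on_GDERIV:
  assumes "C2_on U \<phi>" "\<theta> \<in> U"
  shows "GDERIV \<phi> \<theta> :> grad \<phi> \<theta>"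
  using assms grad_eqI unfolding C2_on_def by metis

lemma C2_on_const: "C2_on (U :: (real^'n) set) (\<lambda>_. c)"
proof -
  have *: "((\<lambda>_. 0) has_derivative (\<lambda>h. (0 :: real^'n^'n) *v h)) (at \<theta>)" for \<theta> :: "real^'n"
    unfolding matrix_vector_mult_0 by (rule has_derivative_const)
  show ?thesis
    unfolding C2_on_def
    by (intro exI[of _ "\<lambda>_. 0"] conjI ballI GDERIV_const * continuous_on_const)
qed

lemma C2_on_add:
  assumes "C2_on U \<phi>" "C2_on U \<psi>"
  shows "C2_on U (\<lambda>\<theta>. \<phi> \<theta> + \<psi> \<theta>)"
proof -
  obtain G1 H1 G2 H2 where
    *: "\<forall>\<theta>\<in>U. GDERIV \<phi> \<theta> :> G1 \<theta>" "\<forall>\<theta>\<in>U. (G1 has_derivative (\<lambda>h. H1 \<theta> *v h)) (at \<theta>)" "continuous_on U H1"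
    "\<forall>\<theta>\<in>U. GDERIV \<psi> \<theta> :> G2 \<theta>" "\<forall>\<theta>\<in>U. (G2 has_derivative (\<lambda>h. H2 \<theta> *v h)) (at \<theta>)" "continuous_on U H2"
    using assms unfolding C2_on_def by blast
  have "((\<lambda>\<theta>. G1 \<theta> + G2 \<theta>) has_derivative (\<lambda>h. (H1 \<theta> + H2 \<theta>) *v h)) (at \<theta>)" if "\<theta> \<in> U" for \<theta>
    unfolding matrix_vector_mult_add_rdistrib using * that by (intro has_derivative_add) auto
  with * show ?thesis
    unfolding C2_on_def
    by (intro exI[of _ "\<lambda>\<theta>. G1 \<theta> + G2 \<theta>"] exI[of _ "\<lambda>\<theta>. H1 \<theta> + H2 \<theta>"])
      (auto intro!: GDERIV_add continuous_on_add)
qed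

lemma C2_on_sum:
  assumes "\<And>i. i \<in> I \<Longrightarrow> C2_on U (f i)"
  shows "C2_on U (\<lambda>\<theta>. \<Sum>i\<in>I. f i \<theta>)"
  using assms by (induction I rule: infinite_finite_induct) (auto intro: C2_on_const C2_on_add)

text \<open>These rank-one matrices are the mixed terms in the Hessian of a product.\<close>

lemma outer_product_mult_vec:
  fixes a b :: "real^'n"
  shows "(\<chi> i j. a $ i * b $ j) *v h = (h \<bullet> b) *\<^sub>R a"
  by (simp add: vec_eq_iff matrix_vector_mult_def inner_vec_def sum_distrib_left mult_ac)

lemma C2_on_mult:
  assumes "C2_on U \<phi>" "C2_on U \<psi>"
  shows "C2_on U (\<lambda>\<theta>. \<phi> \<theta> * \<psi> \<theta>)"
proof -
  obtain G1 H1 G2 H2 where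
    G1: "\<And>\<theta>. \<theta> \<in> U \<Longrightarrow> GDERIV \<phi> \<theta> :> G1 \<theta>" and
    H1: "\<And>\<theta>. \<theta> \<in> U \<Longrightarrow> (G1 has_derivative (\<lambda>h. H1 \<theta> *v h)) (at \<theta>)" and c1: "continuous_on U H1" and
    G2: "\<And>\<theta>. \<theta> \<in> U \<Longrightarrow> GDERIV \<psi> \<theta> :> G2 \<theta>" and
    H2: "\<And>\<theta>. \<theta> \<in> U \<Longrightarrow> (G2 has_derivative (\<lambda>h. H2 \<theta> *v h)) (at \<theta>)" and c2: "continuous_on U H2"
    using assms unfolding C2_on_def by blast
  have cG: "continuous_on U G1" "continuous_on U G2"
    using H1 H2 by (meson continuous_at_imp_continuous_on has_derivative_continuous)+
  have c: "continuous_on U \<phi>" "continuous_on U \<psi>"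
    using G1 G2 unfolding gderiv_def
    by (meson continuous_at_imp_continuous_on has_derivative_continuous)+
  \<comment> \<open>The product rule applied twice. In each outer product the left factor is the
    gradient being kept, the right one the gradient paired with the increment.\<close>
  let ?H = "\<lambda>\<theta>. \<phi> \<theta> *\<^sub>R H2 \<theta> + (\<chi> i j. G2 \<theta> $ i * G1 \<theta> $ j) +
    (\<psi> \<theta> *\<^sub>R H1 \<theta> + (\<chi> i j. G1 \<theta> $ i * G2 \<theta> $ j))"
  show ?thesis
    unfolding C2_on_def
  proof (intro exI[of _ "\<lambda>\<theta>. \<phi> \<theta> *\<^sub>R G2 \<theta> + \<psi> \<theta> *\<^sub>R G1 \<theta>"] exI[of _ ?H] conjI ballI)
    fix \<theta> assume \<theta>: "\<theta> \<in> U"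
    show "GDERIV (\<lambda>\<theta>. \<phi> \<theta> * \<psi> \<theta>) \<theta> :> \<phi> \<theta> *\<^sub>R G2 \<theta> + \<psi> \<theta> *\<^sub>R G1 \<theta>"
      using G1[OF \<theta>] G2[OF \<theta>] by (rule GDERIV_mult)
    have "((\<lambda>\<theta>. \<phi> \<theta> *\<^sub>R G2 \<theta> + \<psi> \<theta> *\<^sub>R G1 \<theta>) has_derivative
        (\<lambda>h. \<phi> \<theta> *\<^sub>R (H2 \<theta> *v h) + (h \<bullet> G1 \<theta>) *\<^sub>R G2 \<theta> +
          (\<psi> \<theta> *\<^sub>R (H1 \<theta> *v h) + (h \<bullet> G2 \<theta>) *\<^sub>R G1 \<theta>))) (at \<theta>)"
      using G1[OF \<theta>] G2[OF \<theta>] H1[OF \<theta>] H2[OF \<theta>] unfolding gderiv_def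
      by (intro has_derivative_add has_derivative_scaleR)
    then show "((\<lambda>\<theta>. \<phi> \<theta> *\<^sub>R G2 \<theta> + \<psi> \<theta> *\<^sub>R G1 \<theta>) has_derivative (\<lambda>h. ?H \<theta> *v h)) (at \<theta>)"
      by (simp add: matrix_vector_mult_add_rdistrib scaleR_matrix_vector_assoc outer_product_mult_vec)
  next
    show "continuous_on U ?H"
      by (intro continuous_intros c cG c1 c2)
  qed
qed

text \<open>The mean value inequality on a convex set: the gradient is differentiable, hence
  continuous, hence bounded on the compact \<open>K\<close>.\<close>

lemma C2_on_lipschitz:
  assumes "C2_on U \<phi>" and K: "K \<subseteq> U" "compact K" "convex K"
  shows "\<exists>C. \<forall>\<theta>\<in>K. \<forall>\<theta>'\<in>K. \<bar>\<phi> \<theta> - \<phi> \<theta>'\<bar> \<le> C * norm (\<theta> - \<theta>')"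
proof -
  obtain G H where G: "\<And>\<theta>. \<theta> \<in> U \<Longrightarrow> GDERIV \<phi> \<theta> :> G \<theta>"
    and H: "\<And>\<theta>. \<theta> \<in> U \<Longrightarrow> (G has_derivative (\<lambda>h. H \<theta> *v h)) (at \<theta>)"
    using assms(1) unfolding C2_on_def by blast
  have "continuous_on K G"
    using H K(1) by (meson continuous_at_imp_continuous_on has_derivative_continuous subsetD)
  then have "bounded (G ` K)" using K(2) by (intro compact_imp_bounded compact_continuous_image)
  then obtain C where C: "\<And>\<theta>. \<theta> \<in> K \<Longrightarrow> norm (G \<theta>) \<le> C" by (auto simp: bounded_iff)
  have "norm (\<phi> \<theta> - \<phi> \<theta>') \<le> C * norm (\<theta> - \<theta>')" if "\<theta> \<in> K" "\<theta>' \<in> K" for \<theta> \<theta>'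
  proof (rule differentiable_bound[OF K(3) _ _ that])
    fix \<eta> assume \<eta>: "\<eta> \<in> K"
    then show "(\<phi> has_derivative (\<lambda>h. h \<bullet> G \<eta>)) (at \<eta> within K)"
      using G K(1) unfolding gderiv_def by (meson has_derivative_at_withinI subsetD)
    have "\<bar>h \<bullet> G \<eta>\<bar> \<le> C * norm h" for h
      using Cauchy_Schwarz_ineq2[of h "G \<eta>"] mult_left_mono[OF C[OF \<eta>] norm_ge_zero[of h]]
      by (simp add: mult.commute)
    then show "onorm (\<lambda>h. h \<bullet> G \<eta>) \<le> C" by (intro onorm_le) simp
  qed
  then show ?thesis by (auto simp: real_norm_def)
qed

text \<open>The bound on the Hessian makes the gradient Lipschitz on \<open>K\<close>. The mean
  value inequality, applied on a segment to the function minus its linear part, then gives a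
  quadratic error with the same constant.\<close>

lemma C2_on_taylor:
  fixes \<phi> :: "real^'n \<Rightarrow> real"
  assumes "C2_on U \<phi>" and K: "K \<subseteq> U" "compact K" "convex K"
  shows "\<exists>C. \<forall>\<theta>\<in>K. \<forall>\<eta>. \<theta> + \<eta> \<in> K \<longrightarrow> \<bar>\<phi> (\<theta> + \<eta>) - \<phi> \<theta> - grad \<phi> \<theta> \<bullet> \<eta>\<bar> \<le> C * (norm \<eta>)\<^sup>2"
proof -
  obtain G H where G: "\<And>\<theta>. \<theta> \<in> U \<Longrightarrow> GDERIV \<phi> \<theta> :> G \<theta>"
    and H: "\<And>\<theta>. \<theta> \<in> U \<Longrightarrow> (G has_derivative (\<lambda>h. H \<theta> *v h)) (at \<theta>)" and "continuous_on U H"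
    using assms(1) unfolding C2_on_def by blast
  have "continuous_on K H" using \<open>continuous_on U H\<close> K(1) by (rule continuous_on_subset)
  then have "bounded (H ` K)" using K(2) by (intro compact_imp_bounded compact_continuous_image)
  then obtain B where B: "\<And>\<theta>. \<theta> \<in> K \<Longrightarrow> norm (H \<theta>) \<le> B" by (auto simp: bounded_iff)
  \<comment> \<open>\<open>B\<close> bounds the entries of the Hessian; the factor
    \<open>real CARD('n) * real CARD('n)\<close> passes from entries to the operator norm.\<close>
  define C where "C = real CARD('n) * real CARD('n) * B"
  have lip: "norm (G \<theta> - G \<theta>') \<le> C * norm (\<theta> - \<theta>')" if "\<theta> \<in> K" "\<theta>' \<in> K" for \<theta> \<theta>'
  proof (rule differentiable_bound[OF K(3) _ _ that])
    fix \<eta> assume \<eta>: "\<eta> \<in> K"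
    then show "(G has_derivative (\<lambda>h. H \<eta> *v h)) (at \<eta> within K)"
      using H K(1) by (meson has_derivative_at_withinI subsetD)
    have "\<bar>H \<eta> $ i $ j\<bar> \<le> B" for i j
      using component_le_norm_cart[of "H \<eta> $ i" j] Finite_Cartesian_Product.norm_nth_le[of "H \<eta>" i] B[OF \<eta>] by linarith
    then show "onorm (\<lambda>h. H \<eta> *v h) \<le> C"
      unfolding C_def by (rule onorm_le_matrix_component)
  qed
  have "\<bar>\<phi> (\<theta> + \<eta>) - \<phi> \<theta> - grad \<phi> \<theta> \<bullet> \<eta>\<bar> \<le> C * (norm \<eta>)\<^sup>2" if \<theta>: "\<theta> \<in> K" "\<theta> + \<eta> \<in> K" for \<theta> \<eta>
  proof -
    let ?S = "closed_segment \<theta> (\<theta> + \<eta>)"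
    have SK: "?S \<subseteq> K" using \<theta> K(3) by (rule closed_segment_subset)
    have "B \<ge> 0" using B[OF \<theta>(1)] norm_ge_zero[of "H \<theta>"] by linarith
    then have C0: "C \<ge> 0" by (simp add: C_def)
    \<comment> \<open>The gradient of \<open>\<phi> x - x \<bullet> G \<theta>\<close> at
      \<open>x\<close> is \<open>G x - G \<theta>\<close>, of norm at most
      \<open>C * norm \<eta>\<close> on the segment.\<close>
    have "norm ((\<phi> (\<theta> + \<eta>) - (\<theta> + \<eta>) \<bullet> G \<theta>) - (\<phi> \<theta> - \<theta> \<bullet> G \<theta>)) \<le> (C * norm \<eta>) * norm (\<theta> + \<eta> - \<theta>)"
    proof (rule differentiable_bound[where S = ?S and f = "\<lambda>x. \<phi> x - x \<bullet> G \<theta>"])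
      fix x assume x: "x \<in> ?S"
      then have "(\<phi> has_derivative (\<lambda>h. h \<bullet> G x)) (at x within ?S)"
        using G SK K(1) unfolding gderiv_def by (meson has_derivative_at_withinI subsetD)
      then show "((\<lambda>x. \<phi> x - x \<bullet> G \<theta>) has_derivative (\<lambda>h. h \<bullet> G x - h \<bullet> G \<theta>)) (at x within ?S)"
        by (intro has_derivative_diff has_derivative_inner_left has_derivative_ident)
      have "norm (x - \<theta>) \<le> norm \<eta>" using segment_bound(1)[OF x] by simp
      then have "norm (G x - G \<theta>) \<le> C * norm \<eta>"
        using lip[of x \<theta>] x SK \<theta>(1) mult_left_mono[OF _ C0] by (meson order_trans subsetD)
      then have "\<bar>h \<bullet> G x - h \<bullet> G \<theta>\<bar> \<le> C * norm \<eta> * norm h" for h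
        using Cauchy_Schwarz_ineq2[of h "G x - G \<theta>"] mult_left_mono[of _ "C * norm \<eta>" "norm h"]
        by (smt (verit) inner_diff_right mult.commute norm_ge_zero)
      then show "onorm (\<lambda>h. h \<bullet> G x - h \<bullet> G \<theta>) \<le> C * norm \<eta>" by (intro onorm_le) simp
    qed auto
    moreover have "grad \<phi> \<theta> = G \<theta>" using G \<theta>(1) K(1) by (auto intro: grad_eqI)
    ultimately show ?thesis
      by (simp add: inner_add_left inner_commute power2_eq_square algebra_simps)
  qed
  then show ?thesis by blast
qed

section \<open>Minima of finite families and their one-sided derivatives\<close>

lemma tendsto_Min:
  fixes f :: "'i \<Rightarrow> 'a \<Rightarrow> real"
  assumes "finite I" "I \<noteq> {}" "\<And>i. i \<in> I \<Longrightarrow> (f i \<longlongrightarrow> l i) F"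
  shows "((\<lambda>x. Min ((\<lambda>i. f i x) ` I)) \<longlongrightarrow> Min (l ` I)) F"
  using assms by (induction I rule: finite_ne_induct) (auto intro: tendsto_min)

lemma tendsto_Max:
  fixes f :: "'i \<Rightarrow> 'a \<Rightarrow> real"
  assumes "finite I" "I \<noteq> {}" "\<And>i. i \<in> I \<Longrightarrow> (f i \<longlongrightarrow> l i) F"
  shows "((\<lambda>x. Max ((\<lambda>i. f i x) ` I)) \<longlongrightarrow> Max (l ` I)) F"
  using assms by (induction I rule: finite_ne_induct) (auto intro: tendsto_max)

text \<open>By continuity, a fixed minimizer \<open>k\<close> at 0 stays strictly below every
  function that is not minimal at 0; finiteness of the family gives one neighbourhood for
  all.\<close>

lemma eventually_argmin_subset:
  fixes f :: "'i \<Rightarrow> real \<Rightarrow> real"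
  assumes I: "finite I" "I \<noteq> {}" and cont: "\<And>i. i \<in> I \<Longrightarrow> isCont (f i) 0"
    and m0: "m0 = Min ((\<lambda>i. f i 0) ` I)"
  shows "\<forall>\<^sub>F h in at 0. \<forall>i\<in>I. f i h = Min ((\<lambda>i. f i h) ` I) \<longrightarrow> f i 0 = m0"
proof -
  have "m0 \<in> (\<lambda>i. f i 0) ` I" unfolding m0 using I by (intro Min_in) auto
  then obtain k where k: "k \<in> I" "f k 0 = m0" by auto
  have "\<forall>\<^sub>F h in at 0. f i h = Min ((\<lambda>i. f i h) ` I) \<longrightarrow> f i 0 = m0" if i: "i \<in> I" for i
  proof (cases "f i 0 = m0")
    case False
    have "m0 \<le> f i 0" unfolding m0 using I i by (intro Min_le) auto
    with False k have pos: "f i 0 - f k 0 > 0" by simp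
    have "((\<lambda>h. f i h - f k h) \<longlongrightarrow> f i 0 - f k 0) (at 0)"
      using cont[OF i] cont[OF k(1)] unfolding isCont_def by (rule tendsto_diff)
    then have "\<forall>\<^sub>F h in at 0. f i h - f k h > 0" using pos by (rule order_tendstoD)
    then show ?thesis
    proof eventually_elim
      case (elim h)
      have "Min ((\<lambda>i. f i h) ` I) \<le> f k h" using I k by (intro Min_le) auto
      with elim show ?case by simp
    qed
  qed simp
  then show ?thesis using I(1) by (simp add: eventually_ball_finite)
qed

text \<open>
  Functions that are not minimal at \<open>0\<close> are not minimal nearby, so only the others contribute
  to the difference quotient of the minimum; dividing by a negative number turns the minimum
  into a maximum.
\<close>

lemma right_derivative_Min:
  fixes f :: "'i \<Rightarrow> real \<Rightarrow> real"
  assumes I: "finite I" "I \<noteq> {}" and D: "\<And>i. i \<in> I \<Longrightarrow> (f i has_real_derivative D i) (at 0)"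
    and m0: "m0 = Min ((\<lambda>i. f i 0) ` I)"
    and m: "\<forall>\<^sub>F h in at_right 0. m h = Min ((\<lambda>i. f i h) ` I)"
  shows "((\<lambda>h. (m h - m0) / h) \<longlongrightarrow> Min (D ` {i\<in>I. f i 0 = m0})) (at_right 0)"
proof -
  let ?A = "{i\<in>I. f i 0 = m0}"
  have "m0 \<in> (\<lambda>i. f i 0) ` I" unfolding m0 using I by (intro Min_in) auto
  then have A: "finite ?A" "?A \<noteq> {}" using I by auto
  have cont: "isCont (f i) 0" if "i \<in> I" for i using D[OF that] by (rule DERIV_isCont)
  have arg: "\<forall>\<^sub>F h in at_right 0. \<forall>i\<in>I. f i h = Min ((\<lambda>i. f i h) ` I) \<longrightarrow> f i 0 = m0"
    using eventually_argmin_subset[OF I cont m0] by (simp add: eventually_at_split)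
  have "((\<lambda>h. (f i h - f i 0) / h) \<longlongrightarrow> D i) (at_right 0)" if "i \<in> ?A" for i
    using D[of i] that unfolding has_field_derivative_iff by (auto simp: filterlim_at_split)
  then have "((\<lambda>h. Min ((\<lambda>i. (f i h - f i 0) / h) ` ?A)) \<longlongrightarrow> Min (D ` ?A)) (at_right 0)"
    by (rule tendsto_Min[OF A])
  moreover have "\<forall>\<^sub>F h in at_right 0. Min ((\<lambda>i. (f i h - f i 0) / h) ` ?A) = (m h - m0) / h"
    using m arg eventually_at_right_less[of 0]
  proof eventually_elim
    case (elim h)
    \<comment> \<open>The minimum at \<open>h\<close> is attained by some \<open>k\<close>, which is
      minimal at 0 as well, so the quotient of the minimum is that of \<open>k\<close>.\<close>
    have "m h \<in> (\<lambda>i. f i h) ` I" unfolding elim(1) using I by (intro Min_in) auto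
    then obtain k where k: "k \<in> I" "f k h = m h" by auto
    with elim have "f k 0 = m0" by auto
    show ?case
    proof (rule Min_eqI)
      show "(m h - m0) / h \<in> (\<lambda>i. (f i h - f i 0) / h) ` ?A"
        using k \<open>f k 0 = m0\<close> by (intro image_eqI[of _ _ k]) auto
      fix y assume "y \<in> (\<lambda>i. (f i h - f i 0) / h) ` ?A"
      then obtain i where i: "i \<in> I" "f i 0 = m0" "y = (f i h - f i 0) / h" by auto
      have "m h \<le> f i h" unfolding elim(1) using I i by (intro Min_le) auto
      with i elim(3) show "(m h - m0) / h \<le> y" by (simp add: divide_right_mono)
    qed (use A in auto)
  qed
  ultimately show ?thesis by (rule Lim_transform_eventually)
qed

lemma left_derivative_Min:
  fixes f :: "'i \<Rightarrow> real \<Rightarrow> real"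
  assumes I: "finite I" "I \<noteq> {}" and D: "\<And>i. i \<in> I \<Longrightarrow> (f i has_real_derivative D i) (at 0)"
    and m0: "m0 = Min ((\<lambda>i. f i 0) ` I)"
    and m: "\<forall>\<^sub>F h in at_left 0. m h = Min ((\<lambda>i. f i h) ` I)"
  shows "((\<lambda>h. (m h - m0) / h) \<longlongrightarrow> Max (D ` {i\<in>I. f i 0 = m0})) (at_left 0)"
proof -
  let ?A = "{i\<in>I. f i 0 = m0}"
  have "m0 \<in> (\<lambda>i. f i 0) ` I" unfolding m0 using I by (intro Min_in) auto
  then have A: "finite ?A" "?A \<noteq> {}" using I by auto
  have cont: "isCont (f i) 0" if "i \<in> I" for i using D[OF that] by (rule DERIV_isCont)
  have arg: "\<forall>\<^sub>F h in at_left 0. \<forall>i\<in>I. f i h = Min ((\<lambda>i. f i h) ` I) \<longrightarrow> f i 0 = m0"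
    using eventually_argmin_subset[OF I cont m0] by (simp add: eventually_at_split)
  have "((\<lambda>h. (f i h - f i 0) / h) \<longlongrightarrow> D i) (at_left 0)" if "i \<in> ?A" for i
    using D[of i] that unfolding has_field_derivative_iff by (auto simp: filterlim_at_split)
  then have "((\<lambda>h. Max ((\<lambda>i. (f i h - f i 0) / h) ` ?A)) \<longlongrightarrow> Max (D ` ?A)) (at_left 0)"
    by (rule tendsto_Max[OF A])
  moreover have "\<forall>\<^sub>F h in at_left (0::real). h < 0" by (simp add: eventually_at_filter)
  with m arg have "\<forall>\<^sub>F h in at_left 0. Max ((\<lambda>i. (f i h - f i 0) / h) ` ?A) = (m h - m0) / h"
  proof eventually_elim
    case (elim h)
    have "m h \<in> (\<lambda>i. f i h) ` I" unfolding elim(1) using I by (intro Min_in) auto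
    then obtain k where k: "k \<in> I" "f k h = m h" by auto
    with elim have "f k 0 = m0" by auto
    show ?case
    proof (rule Max_eqI)
      show "(m h - m0) / h \<in> (\<lambda>i. (f i h - f i 0) / h) ` ?A"
        using k \<open>f k 0 = m0\<close> by (intro image_eqI[of _ _ k]) auto
      fix y assume "y \<in> (\<lambda>i. (f i h - f i 0) / h) ` ?A"
      then obtain i where i: "i \<in> I" "f i 0 = m0" "y = (f i h - f i 0) / h" by auto
      have "m h \<le> f i h" unfolding elim(1) using I i by (intro Min_le) auto
      with i elim(3) show "y \<le> (m h - m0) / h" by (simp add: divide_right_mono_neg)
    qed (use A in auto)
  qed
  ultimately show ?thesis by (rule Lim_transform_eventually)
qed

text \<open>The minimizer of one family is a competitor in the other.\<close>

lemma abs_Min_diff_le: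
  fixes f g :: "'i \<Rightarrow> real"
  assumes "finite I" "I \<noteq> {}" and le: "\<And>i. i \<in> I \<Longrightarrow> \<bar>f i - g i\<bar> \<le> C"
  shows "\<bar>Min (f ` I) - Min (g ` I)\<bar> \<le> C"
proof -
  have "Min (f ` I) \<in> f ` I" "Min (g ` I) \<in> g ` I"
    using assms(1,2) by (intro Min_in; simp)+
  then obtain i j where i: "i \<in> I" "Min (f ` I) = f i" and j: "j \<in> I" "Min (g ` I) = g j"
    by (elim imageE)
  have "f i \<le> f j" unfolding i(2)[symmetric] using assms j by (intro Min_le) auto
  moreover have "g j \<le> g i" unfolding j(2)[symmetric] using assms i by (intro Min_le) auto
  ultimately show ?thesis unfolding i(2) j(2) using le[OF i(1)] le[OF j(1)] by linarith
qed

text \<open>The sum of absolute values dominates every constant, is nonnegative, and makes sense for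
  an empty family as well.\<close>

lemma uniform_constant:
  fixes P :: "'i \<Rightarrow> real \<Rightarrow> bool"
  assumes "finite I" "\<And>i. i \<in> I \<Longrightarrow> \<exists>C. P i C" "\<And>i C C'. P i C \<Longrightarrow> C \<le> C' \<Longrightarrow> P i C'"
  shows "\<exists>C\<ge>0. \<forall>i\<in>I. P i C"
proof -
  obtain c where c: "\<And>i. i \<in> I \<Longrightarrow> P i (c i)" using assms(2) by metis
  show ?thesis
  proof (intro exI conjI ballI)
    show "(\<Sum>i\<in>I. \<bar>c i\<bar>) \<ge> 0" by (simp add: sum_nonneg)
    fix i assume i: "i \<in> I"
    have "c i \<le> \<bar>c i\<bar>" by simp
    also have "\<dots> \<le> (\<Sum>i\<in>I. \<bar>c i\<bar>)" using assms(1) i by (intro member_le_sum) auto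
    finally show "P i (\<Sum>i\<in>I. \<bar>c i\<bar>)" by (rule assms(3)[OF c[OF i]])
  qed
qed

section \<open>Path expectations\<close>

context robust_mdp
begin

text \<open>Finite support reduces expectations over paths to finite sums, and keeping the path
  inside the states lets the assumptions on policies and selections apply along it.\<close>

lemma path_law_support:
  assumes \<sigma>: "\<sigma> \<in> selections M" and \<theta>: "\<theta> \<in> Theta M" and "n \<le> horizon M"
  shows "finite (set_pmf (path_law M \<sigma> \<theta> n)) \<and>
    (\<forall>(X, \<alpha>)\<in>set_pmf (path_law M \<sigma> \<theta> n). \<forall>t\<le>n. X t \<in> states M)"
  using assms(3)
proof (induction n)
  case 0
  then show ?case
    using initial_states finite_subset[OF initial_states finite_states] by auto
next
  case (Suc n)
  then have n: "n < horizon M" by simp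
  from Suc have fin: "finite (set_pmf (path_law M \<sigma> \<theta> n))"
    and X: "\<And>X \<alpha> t. (X, \<alpha>) \<in> set_pmf (path_law M \<sigma> \<theta> n) \<Longrightarrow> t \<le> n \<Longrightarrow> X t \<in> states M" by auto
  have pol: "set_pmf (policy M n \<theta> x) \<subseteq> actions M" if "x \<in> states M" for x
    using policy_actions[OF n \<theta> that] .
  have sel: "set_pmf (\<sigma> (n, x, a)) \<subseteq> states M" if "x \<in> states M" "a \<in> actions M" for x a
    using selection_support[OF \<sigma> n that] .
  have "finite (set_pmf (path_law M \<sigma> \<theta> (Suc n)))"
    using fin X[OF _ order_refl] pol sel finite_subset[OF pol finite_actions] finite_subset[OF sel finite_states]
    by (auto simp: set_bind_pmf) blast
  moreover have "X t \<in> states M"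
    if mem: "(X, \<alpha>) \<in> set_pmf (path_law M \<sigma> \<theta> (Suc n))" and t: "t \<le> Suc n" for X \<alpha> t
  proof -
    obtain X' \<alpha>' a y where *: "(X', \<alpha>') \<in> set_pmf (path_law M \<sigma> \<theta> n)"
      "a \<in> set_pmf (policy M n \<theta> (X' n))" "y \<in> set_pmf (\<sigma> (n, X' n, a))" "X = X'(Suc n := y)"
      using mem by (auto simp: set_bind_pmf)
    have "X' n \<in> states M" using X[OF *(1)] by simp
    with * pol sel have "y \<in> states M" by blast
    with *(1,4) X t show ?thesis by (cases "t = Suc n") auto
  qed
  ultimately show ?case by blast
qed

text \<open>The expectation of the sum over \<open>t < n\<close> plus \<open>W n (X n)\<close> does not depend on \<open>n\<close>.\<close>

lemma path_expectation_eq_value: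
  fixes c :: "nat \<Rightarrow> real^'d \<Rightarrow> real^'m \<Rightarrow> 'b::{banach, second_countable_topology}"
  assumes \<sigma>: "\<sigma> \<in> selections M" and \<theta>: "\<theta> \<in> Theta M"
    and step: "\<And>t x. t < horizon M \<Longrightarrow> x \<in> states M \<Longrightarrow>
      W t x = (\<Sum>a\<in>actions M. pmf (policy M t \<theta> x) a *\<^sub>R
        (c t x a + (\<Sum>y\<in>states M. pmf (\<sigma> (t, x, a)) y *\<^sub>R W (Suc t) y)))"
    and final: "\<And>x. x \<in> states M \<Longrightarrow> W (horizon M) x = 0"
  shows "path_expectation M \<sigma> \<theta> (\<lambda>X \<alpha>. \<Sum>t<horizon M. c t (X t) (\<alpha> t)) =
    (\<Sum>x\<in>states M. pmf (initial M) x *\<^sub>R W 0 x)"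
proof -
  let ?L = "path_law M \<sigma> \<theta>"
  \<comment> \<open>A martingale under the path law: contributions so far plus the value still to
    come. Values in a Banach space let one argument serve both the scalar gaps and the vector-valued
    scores.\<close>
  define S where "S n = (\<lambda>(X, \<alpha>). (\<Sum>t<n. c t (X t) (\<alpha> t)) + W n (X n))" for n
  have "measure_pmf.expectation (?L n) (S n) = (\<Sum>x\<in>states M. pmf (initial M) x *\<^sub>R W 0 x)"
    if "n \<le> horizon M" for n
    using that
  proof (induction n)
    case 0
    show ?case
      using initial_states
      by (simp add: S_def integral_measure_pmf[OF finite_states] subset_iff)
  next
    case (Suc n)
    then have n: "n < horizon M" by simp
    note fin = path_law_support[OF \<sigma> \<theta> less_imp_le[OF n]]
    \<comment> \<open>Expectation given the path up to \<open>n\<close>. Overwriting the state at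
      \<open>Suc n\<close> and the action at \<open>n\<close> leaves the first \<open>n\<close>
      terms unchanged, and \<open>step\<close> collapses the rest to
      \<open>W n (X n)\<close>.\<close>
    have one_step: "measure_pmf.expectation (policy M n \<theta> (X n) \<bind>
          (\<lambda>a. map_pmf (\<lambda>y. (X(Suc n := y), \<alpha>(n := a))) (\<sigma> (n, X n, a)))) (S (Suc n)) = S n (X, \<alpha>)"
      if XL: "(X, \<alpha>) \<in> set_pmf (?L n)" for X \<alpha>
    proof -
      have x: "X n \<in> states M" using fin XL by auto
      let ?s = "\<Sum>t<n. c t (X t) (\<alpha> t)"
      have inner: "measure_pmf.expectation (map_pmf (\<lambda>y. (X(Suc n := y), \<alpha>(n := a))) (\<sigma> (n, X n, a))) (S (Suc n))
          = ?s + (c n (X n) a + (\<Sum>y\<in>states M. pmf (\<sigma> (n, X n, a)) y *\<^sub>R W (Suc n) y))"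
        if a: "a \<in> actions M" for a
      proof -
        note supp = selection_support[OF \<sigma> n x a]
        have "S (Suc n) (X(Suc n := y), \<alpha>(n := a)) = ?s + c n (X n) a + W (Suc n) y" for y
          by (simp add: S_def)
        then have "measure_pmf.expectation (map_pmf (\<lambda>y. (X(Suc n := y), \<alpha>(n := a))) (\<sigma> (n, X n, a))) (S (Suc n))
            = (\<Sum>y\<in>states M. pmf (\<sigma> (n, X n, a)) y *\<^sub>R (?s + c n (X n) a + W (Suc n) y))"
          using supp by (simp add: integral_measure_pmf[OF finite_states] subset_iff)
        also have "\<dots> = (\<Sum>y\<in>states M. pmf (\<sigma> (n, X n, a)) y) *\<^sub>R (?s + c n (X n) a)
            + (\<Sum>y\<in>states M. pmf (\<sigma> (n, X n, a)) y *\<^sub>R W (Suc n) y)"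
          by (simp only: scaleR_add_right sum.distrib scaleR_sum_left)
        finally show ?thesis using sum_pmf_eq_1[OF finite_states supp] by (simp add: add.assoc)
      qed
      have "measure_pmf.expectation (policy M n \<theta> (X n) \<bind>
          (\<lambda>a. map_pmf (\<lambda>y. (X(Suc n := y), \<alpha>(n := a))) (\<sigma> (n, X n, a)))) (S (Suc n))
        = (\<Sum>a\<in>actions M. pmf (policy M n \<theta> (X n)) a *\<^sub>R
            (?s + (c n (X n) a + (\<Sum>y\<in>states M. pmf (\<sigma> (n, X n, a)) y *\<^sub>R W (Suc n) y))))"
        using policy_actions[OF n \<theta> x] inner finite_subset[OF selection_support[OF \<sigma> n x] finite_states]
        by (subst pmf_expectation_bind[OF finite_actions]) auto
      also have "\<dots> = (\<Sum>a\<in>actions M. pmf (policy M n \<theta> (X n)) a) *\<^sub>R ?s + W n (X n)"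
        unfolding step[OF n x] by (simp only: scaleR_add_right[of _ ?s] sum.distrib scaleR_sum_left)
      finally show ?thesis using sum_policy[OF \<theta> n x] by (simp add: S_def)
    qed
    have fin_step: "finite (set_pmf (policy M n \<theta> (X n) \<bind>
          (\<lambda>a. map_pmf (\<lambda>y. (X(Suc n := y), \<alpha>(n := a))) (\<sigma> (n, X n, a)))))"
      if "(X, \<alpha>) \<in> set_pmf (?L n)" for X \<alpha>
    proof -
      have x: "X n \<in> states M" using fin that by auto
      then show ?thesis
        using policy_actions[OF n \<theta> x] finite_subset[OF policy_actions[OF n \<theta> x] finite_actions]
          finite_subset[OF selection_support[OF \<sigma> n x] finite_states]
        by (auto simp: set_bind_pmf)
    qed
    have "measure_pmf.expectation (?L (Suc n)) (S (Suc n))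
        = (\<Sum>p\<in>set_pmf (?L n). pmf (?L n) p *\<^sub>R S n p)"
      using fin fin_step one_step
      by (simp add: case_prod_unfold) (subst pmf_expectation_bind[where A = "set_pmf (?L n)"], auto)
    also have "\<dots> = measure_pmf.expectation (?L n) (S n)"
      using fin by (subst integral_measure_pmf[of "set_pmf (?L n)"]) auto
    finally show ?case using Suc by simp
  qed
  from this[OF order_refl] show ?thesis
  proof (rule trans[rotated])
    \<comment> \<open>The last state of almost every path lies in \<open>states M\<close>, where the
      remaining value is zero.\<close>
    have "measure_pmf.expectation (?L (horizon M)) (\<lambda>(X, \<alpha>). \<Sum>t<horizon M. c t (X t) (\<alpha> t))
        = measure_pmf.expectation (?L (horizon M)) (S (horizon M))"
      using path_law_support[OF \<sigma> \<theta> order_refl] final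
      by (intro integral_cong_AE) (auto simp: AE_measure_pmf_iff S_def)
    then show "path_expectation M \<sigma> \<theta> (\<lambda>X \<alpha>. \<Sum>t<horizon M. c t (X t) (\<alpha> t))
        = measure_pmf.expectation (?L (horizon M)) (S (horizon M))"
      by (simp add: path_expectation_def)
  qed
qed

text \<open>The difference of the two value functions solves the backward recursion whose running
  term is the gap.\<close>

lemma performance_difference:
  assumes \<sigma>: "\<sigma> \<in> selections M" and \<theta>: "\<theta> \<in> Theta M"
  shows "J_sel M \<sigma> \<theta> - J_rob M \<theta> =
    path_expectation M \<sigma> \<theta> (\<lambda>X \<alpha>. \<Sum>t<horizon M. gap M \<sigma> \<theta> t (X t) (\<alpha> t))"
proof -
  define W where "W t x = V_sel M \<sigma> \<theta> t x - V_rob M \<theta> t x" for t x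
  have "W t x = (\<Sum>a\<in>actions M. pmf (policy M t \<theta> x) a *\<^sub>R
        (gap M \<sigma> \<theta> t x a + (\<Sum>y\<in>states M. pmf (\<sigma> (t, x, a)) y *\<^sub>R W (Suc t) y)))"
    if t: "t < horizon M" for t x
  proof -
    \<comment> \<open>Split at the value of the selected law against the robust next value: changing
      the law costs the gap, changing the next value costs the average of
      \<open>W (Suc t)\<close>.\<close>
    have "gap M \<sigma> \<theta> t x a + (\<Sum>y\<in>states M. pmf (\<sigma> (t, x, a)) y *\<^sub>R W (Suc t) y)
        = Q_sel M \<sigma> \<theta> t x a - G_rob M \<theta> t x a" for a
      using step_value_diff[of M t x a "\<sigma> (t, x, a)" "V_sel M \<sigma> \<theta> (Suc t)" "V_rob M \<theta> (Suc t)"]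
      by (simp add: gap_def Q_sel_def W_def)
    then show ?thesis
      by (simp add: W_def V_sel_step[OF t] V_rob_step[OF t] sum_subtractf right_diff_distrib)
  qed
  moreover have "W (horizon M) x = 0" for x by (simp add: W_def V_sel_horizon V_rob_horizon)
  ultimately have "path_expectation M \<sigma> \<theta> (\<lambda>X \<alpha>. \<Sum>t<horizon M. gap M \<sigma> \<theta> t (X t) (\<alpha> t))
      = (\<Sum>x\<in>states M. pmf (initial M) x *\<^sub>R W 0 x)"
    by (intro path_expectation_eq_value[OF \<sigma> \<theta>])
  then show ?thesis
    by (simp add: J_sel_def J_rob_def W_def sum_subtractf right_diff_distrib)
qed

end

section \<open>Smoothness in the policy parameter\<close>

lemma Theta_eq_cbox: "Theta M = cbox (\<chi> i. - bound M) (\<chi> i. bound M)"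
  by (auto simp: Theta_def mem_box_cart)

lemma norm_le_sqrt_infnorm: "norm (x :: real^'n) \<le> sqrt (real CARD('n)) * infnorm x"
  using norm_le_infnorm[of x] by simp

context robust_mdp
begin

text \<open>The model supplies one neighbourhood per triple, while sums and products over triples
  require a common one; a finite intersection of open sets provides it.\<close>

definition smooth_nbhd :: "(real^'n) set \<Rightarrow> bool" where
  "smooth_nbhd U \<longleftrightarrow> open U \<and> Theta M \<subseteq> U \<and>
     (\<forall>t<horizon M. \<forall>x\<in>states M. \<forall>a\<in>actions M. (\<forall>\<theta>\<in>U. pmf (policy M t \<theta> x) a > 0) \<and>
       C2_on U (\<lambda>\<theta>. pmf (policy M t \<theta> x) a))"

lemma ex_smooth_nbhd: "\<exists>U. smooth_nbhd U"
proof -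
  have "\<exists>U. open U \<and> Theta M \<subseteq> U \<and> (\<forall>\<theta>\<in>U. pmf (policy M (fst p) \<theta> (fst (snd p))) (snd (snd p)) > 0) \<and>
      C2_on U (\<lambda>\<theta>. pmf (policy M (fst p) \<theta> (fst (snd p))) (snd (snd p)))" if "p \<in> triples M" for p
    using that policy_smooth by (auto simp: triples_def)
  then obtain N where N: "\<And>p. p \<in> triples M \<Longrightarrow> open (N p) \<and> Theta M \<subseteq> N p \<and>
      (\<forall>\<theta>\<in>N p. pmf (policy M (fst p) \<theta> (fst (snd p))) (snd (snd p)) > 0) \<and>
      C2_on (N p) (\<lambda>\<theta>. pmf (policy M (fst p) \<theta> (fst (snd p))) (snd (snd p)))"
    by metis
  define U where "U = (\<Inter>p\<in>triples M. N p)"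
  have "open U" unfolding U_def using N finite_triples by (intro open_INT) auto
  moreover have "Theta M \<subseteq> U" unfolding U_def using N by blast
  moreover have "(\<forall>\<theta>\<in>U. pmf (policy M t \<theta> x) a > 0) \<and> C2_on U (\<lambda>\<theta>. pmf (policy M t \<theta> x) a)"
    if "t < horizon M" "x \<in> states M" "a \<in> actions M" for t x a
  proof -
    have p: "(t, x, a) \<in> triples M" using that by (simp add: triples_def)
    then have sub: "U \<subseteq> N (t, x, a)" unfolding U_def by blast
    show ?thesis using N[OF p] C2_on_subset[OF _ sub] sub by auto
  qed
  ultimately have "smooth_nbhd U" by (simp add: smooth_nbhd_def)
  then show ?thesis by blast
qed

definition nbhd :: "(real^'n) set" where
  "nbhd = (SOME U. smooth_nbhd U)"

lemma smooth_nbhd_nbhd: "smooth_nbhd nbhd"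
  unfolding nbhd_def using ex_smooth_nbhd by (rule someI_ex)

lemma open_nbhd: "open nbhd" and Theta_subset_nbhd: "Theta M \<subseteq> nbhd"
  using smooth_nbhd_nbhd by (simp_all add: smooth_nbhd_def)

lemma policy_pos:
  assumes "t < horizon M" "x \<in> states M" "a \<in> actions M" "\<theta> \<in> nbhd"
  shows "pmf (policy M t \<theta> x) a > 0"
  using smooth_nbhd_nbhd assms unfolding smooth_nbhd_def by simp

lemma policy_C2:
  assumes "t < horizon M" "x \<in> states M" "a \<in> actions M"
  shows "C2_on nbhd (\<lambda>\<theta>. pmf (policy M t \<theta> x) a)"
  using smooth_nbhd_nbhd assms unfolding smooth_nbhd_def by simp

lemma C2_on_step_value:
  assumes "\<And>y. y \<in> states M \<Longrightarrow> C2_on U (\<lambda>\<theta>. v \<theta> y)"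
  shows "C2_on U (\<lambda>\<theta>. step_value M t x a P (v \<theta>))"
  unfolding step_value_def pairing_def
  using assms by (intro C2_on_sum C2_on_mult C2_on_add C2_on_const)

lemma V_sel_C2:
  assumes "t \<le> horizon M" "x \<in> states M"
  shows "C2_on nbhd (\<lambda>\<theta>. V_sel M \<sigma> \<theta> t x)"
  using assms
proof (induction t arbitrary: x rule: inc_induct)
  case base
  show ?case unfolding V_sel_horizon by (rule C2_on_const)
next
  case (step t)
  show ?case
    unfolding V_sel_step[OF step.hyps(2)] Q_sel_def
    by (intro C2_on_sum C2_on_mult C2_on_step_value policy_C2 step)
qed

lemma Q_sel_C2:
  assumes "t < horizon M"
  shows "C2_on nbhd (\<lambda>\<theta>. Q_sel M \<sigma> \<theta> t x a)"
  unfolding Q_sel_def using assms by (intro C2_on_step_value V_sel_C2) auto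

lemma J_sel_C2: "C2_on nbhd (J_sel M \<sigma>)"
  unfolding J_sel_def[abs_def] by (intro C2_on_sum C2_on_mult C2_on_const V_sel_C2) auto

text \<open>Differentiating the backward recursion of \<open>V_sel\<close> gives a recursion for the
  gradients \<open>W\<close>: differentiating the policy produces \<open>Q_sel\<close> times the
  score as running term, differentiating \<open>Q_sel\<close> produces the gradient at the next
  time.\<close>

lemma policy_gradient:
  assumes \<sigma>: "\<sigma> \<in> selections M" and \<theta>: "\<theta> \<in> Theta M"
  shows "grad (J_sel M \<sigma>) \<theta> = path_expectation M \<sigma> \<theta> (\<lambda>X \<alpha>. \<Sum>t<horizon M.
    Q_sel M \<sigma> \<theta> t (X t) (\<alpha> t) *\<^sub>R grad (\<lambda>\<theta>'. ln (pmf (policy M t \<theta>' (X t)) (\<alpha> t))) \<theta>)"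
proof -
  define W where "W t x = grad (\<lambda>\<theta>. V_sel M \<sigma> \<theta> t x) \<theta>" for t x
  have \<theta>U: "\<theta> \<in> nbhd" using \<theta> Theta_subset_nbhd by blast
  have V: "GDERIV (\<lambda>\<theta>. V_sel M \<sigma> \<theta> t x) \<theta> :> W t x" if "t \<le> horizon M" "x \<in> states M" for t x
    unfolding W_def by (rule C2_on_GDERIV[OF V_sel_C2[OF that] \<theta>U])
  have "W t x = (\<Sum>a\<in>actions M. pmf (policy M t \<theta> x) a *\<^sub>R
        (Q_sel M \<sigma> \<theta> t x a *\<^sub>R grad (\<lambda>\<theta>'. ln (pmf (policy M t \<theta>' x) a)) \<theta> +
          (\<Sum>y\<in>states M. pmf (\<sigma> (t, x, a)) y *\<^sub>R W (Suc t) y)))"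
    if t: "t < horizon M" and x: "x \<in> states M" for t x
  proof -
    let ?p = "\<lambda>a \<theta>. pmf (policy M t \<theta> x) a"
    have p: "GDERIV (?p a) \<theta> :> grad (?p a) \<theta>" and pos: "?p a \<theta> > 0" if a: "a \<in> actions M" for a
      using C2_on_GDERIV[OF policy_C2[OF t x a] \<theta>U] policy_pos[OF t x a \<theta>U] .
    \<comment> \<open>Positivity of the policy near the box gives the log-derivative identity, which
      writes \<open>grad (?p a)\<close> as a probability times a score.\<close>
    have ln: "grad (\<lambda>\<theta>. ln (?p a \<theta>)) \<theta> = (1 / ?p a \<theta>) *\<^sub>R grad (?p a) \<theta>" if a: "a \<in> actions M" for a
      using pos[OF a] by (intro grad_eqI GDERIV_DERIV_compose[OF p[OF a]]) (auto intro!: derivative_eq_intros)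
    have Q: "GDERIV (\<lambda>\<theta>. Q_sel M \<sigma> \<theta> t x a) \<theta> :> (\<Sum>y\<in>states M. pmf (\<sigma> (t, x, a)) y *\<^sub>R W (Suc t) y)" for a
      unfolding Q_sel_def step_value_def pairing_def
    proof (rule GDERIV_sum)
      fix y assume y: "y \<in> states M"
      have "GDERIV (\<lambda>\<theta>. reward M t x a y + V_sel M \<sigma> \<theta> (Suc t) y) \<theta> :> 0 + W (Suc t) y"
        using t y by (intro GDERIV_add GDERIV_const V) auto
      from GDERIV_mult[OF GDERIV_const this]
      show "GDERIV (\<lambda>\<theta>. pmf (\<sigma> (t, x, a)) y * (reward M t x a y + V_sel M \<sigma> \<theta> (Suc t) y)) \<theta>
          :> pmf (\<sigma> (t, x, a)) y *\<^sub>R W (Suc t) y"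
        by (rule GDERIV_subst) simp
    qed
    have "GDERIV (\<lambda>\<theta>. \<Sum>a\<in>actions M. ?p a \<theta> * Q_sel M \<sigma> \<theta> t x a) \<theta> :> (\<Sum>a\<in>actions M.
        ?p a \<theta> *\<^sub>R (\<Sum>y\<in>states M. pmf (\<sigma> (t, x, a)) y *\<^sub>R W (Suc t) y)
        + Q_sel M \<sigma> \<theta> t x a *\<^sub>R grad (?p a) \<theta>)"
      by (intro GDERIV_sum GDERIV_mult p Q)
    then have "W t x = (\<Sum>a\<in>actions M.
        ?p a \<theta> *\<^sub>R (\<Sum>y\<in>states M. pmf (\<sigma> (t, x, a)) y *\<^sub>R W (Suc t) y)
        + Q_sel M \<sigma> \<theta> t x a *\<^sub>R grad (?p a) \<theta>)"
      unfolding W_def[of t] V_sel_step[OF t] by (rule grad_eqI)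
    also have "\<dots> = (\<Sum>a\<in>actions M. ?p a \<theta> *\<^sub>R
        (Q_sel M \<sigma> \<theta> t x a *\<^sub>R grad (\<lambda>\<theta>'. ln (?p a \<theta>')) \<theta> +
          (\<Sum>y\<in>states M. pmf (\<sigma> (t, x, a)) y *\<^sub>R W (Suc t) y)))"
    proof (rule sum.cong[OF refl])
      fix a assume a: "a \<in> actions M"
      have "?p a \<theta> *\<^sub>R (Q_sel M \<sigma> \<theta> t x a *\<^sub>R grad (\<lambda>\<theta>'. ln (?p a \<theta>')) \<theta>)
          = Q_sel M \<sigma> \<theta> t x a *\<^sub>R grad (?p a) \<theta>"
        using pos[OF a] by (simp add: ln[OF a])
      then show "?p a \<theta> *\<^sub>R (\<Sum>y\<in>states M. pmf (\<sigma> (t, x, a)) y *\<^sub>R W (Suc t) y)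
        + Q_sel M \<sigma> \<theta> t x a *\<^sub>R grad (?p a) \<theta> = ?p a \<theta> *\<^sub>R
        (Q_sel M \<sigma> \<theta> t x a *\<^sub>R grad (\<lambda>\<theta>'. ln (?p a \<theta>')) \<theta> +
          (\<Sum>y\<in>states M. pmf (\<sigma> (t, x, a)) y *\<^sub>R W (Suc t) y))"
        by (simp only: scaleR_add_right add.commute)
    qed
    finally show ?thesis .
  qed
  \<comment> \<open>The terminal reward does not depend on the parameter.\<close>
  moreover have "W (horizon M) x = 0" for x
    unfolding W_def V_sel_horizon by (intro grad_eqI GDERIV_const)
  ultimately have "path_expectation M \<sigma> \<theta> (\<lambda>X \<alpha>. \<Sum>t<horizon M.
      Q_sel M \<sigma> \<theta> t (X t) (\<alpha> t) *\<^sub>R grad (\<lambda>\<theta>'. ln (pmf (policy M t \<theta>' (X t)) (\<alpha> t))) \<theta>)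
    = (\<Sum>x\<in>states M. pmf (initial M) x *\<^sub>R W 0 x)"
    by (intro path_expectation_eq_value[OF \<sigma> \<theta>])
  moreover have "GDERIV (J_sel M \<sigma>) \<theta> :> (\<Sum>x\<in>states M. pmf (initial M) x *\<^sub>R W 0 x)"
    unfolding J_sel_def[abs_def]
  proof (rule GDERIV_sum)
    fix x assume "x \<in> states M"
    from GDERIV_mult[OF GDERIV_const V[OF le0 this]]
    show "GDERIV (\<lambda>\<theta>. pmf (initial M) x * V_sel M \<sigma> \<theta> 0 x) \<theta> :> pmf (initial M) x *\<^sub>R W 0 x"
      by (rule GDERIV_subst) simp
  qed
  ultimately show ?thesis by (simp add: grad_eqI)
qed

text \<open>Written with the zero step \<open>0 *\<^sub>R r\<close>, so that the set is the one of
  the functions minimal at 0 among the restrictions to the line.\<close>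

lemma optimal_selections_eq:
  "optimal_selections M \<theta> = {\<sigma>\<in>selections M. J_sel M \<sigma> (\<theta> + 0 *\<^sub>R r) = J_rob M \<theta>}"
  by (simp add: optimal_selections_def)

lemma J_sel_line_derivative:
  assumes "\<theta> \<in> Theta M"
  shows "((\<lambda>h. J_sel M \<sigma> (\<theta> + h *\<^sub>R r)) has_real_derivative grad (J_sel M \<sigma>) \<theta> \<bullet> r) (at 0)"
  using assms Theta_subset_nbhd by (intro GDERIV_line C2_on_GDERIV[OF J_sel_C2]) auto

text \<open>Each \<open>J_sel\<close> is differentiable along the line at 0, even at the boundary of
  the box. Feasibility of \<open>r\<close> enters because the minimum formula for
  \<open>J_rob\<close> is available on \<open>Theta M\<close>.\<close>

lemma J_rob_right_derivative:
  assumes \<theta>: "\<theta> \<in> Theta M" and r: "\<forall>\<^sub>F h in at_right 0. \<theta> + h *\<^sub>R r \<in> Theta M"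
  shows "((\<lambda>h. (J_rob M (\<theta> + h *\<^sub>R r) - J_rob M \<theta>) / h) \<longlongrightarrow>
    Min ((\<lambda>\<sigma>. grad (J_sel M \<sigma>) \<theta> \<bullet> r) ` optimal_selections M \<theta>)) (at_right 0)"
  unfolding optimal_selections_eq[of \<theta> r]
proof (rule right_derivative_Min[OF finite_selections selections_nonempty J_sel_line_derivative[OF \<theta>]])
  show "J_rob M \<theta> = Min ((\<lambda>\<sigma>. J_sel M \<sigma> (\<theta> + 0 *\<^sub>R r)) ` selections M)"
    using J_rob_eq_Min[OF \<theta>] by simp
  show "\<forall>\<^sub>F h in at_right 0. J_rob M (\<theta> + h *\<^sub>R r) = Min ((\<lambda>\<sigma>. J_sel M \<sigma> (\<theta> + h *\<^sub>R r)) ` selections M)"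
    using r by eventually_elim (rule J_rob_eq_Min)
qed

lemma J_rob_left_derivative:
  assumes \<theta>: "\<theta> \<in> Theta M" and r: "\<forall>\<^sub>F h in at_left 0. \<theta> + h *\<^sub>R r \<in> Theta M"
  shows "((\<lambda>h. (J_rob M (\<theta> + h *\<^sub>R r) - J_rob M \<theta>) / h) \<longlongrightarrow>
    Max ((\<lambda>\<sigma>. grad (J_sel M \<sigma>) \<theta> \<bullet> r) ` optimal_selections M \<theta>)) (at_left 0)"
  unfolding optimal_selections_eq[of \<theta> r]
proof (rule left_derivative_Min[OF finite_selections selections_nonempty J_sel_line_derivative[OF \<theta>]])
  show "J_rob M \<theta> = Min ((\<lambda>\<sigma>. J_sel M \<sigma> (\<theta> + 0 *\<^sub>R r)) ` selections M)"
    using J_rob_eq_Min[OF \<theta>] by simp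
  show "\<forall>\<^sub>F h in at_left 0. J_rob M (\<theta> + h *\<^sub>R r) = Min ((\<lambda>\<sigma>. J_sel M \<sigma> (\<theta> + h *\<^sub>R r)) ` selections M)"
    using r by eventually_elim (rule J_rob_eq_Min)
qed

section \<open>Uniform constants on the box\<close>

lemma compact_Theta: "compact (Theta M)" and convex_Theta: "convex (Theta M)"
  unfolding Theta_eq_cbox by (rule compact_cbox convex_box)+

text \<open>The mean value bound is Euclidean; the factor \<open>sqrt (real CARD('n))\<close>
  converts it to the sup norm.\<close>

lemma uniform_lipschitz:
  assumes "finite I" "\<And>i. i \<in> I \<Longrightarrow> C2_on nbhd (\<phi> i)"
  obtains C where "C \<ge> 0"
    "\<And>i \<theta> \<theta>'. i \<in> I \<Longrightarrow> \<theta> \<in> Theta M \<Longrightarrow> \<theta>' \<in> Theta M \<Longrightarrow> \<bar>\<phi> i \<theta> - \<phi> i \<theta>'\<bar> \<le> C * infnorm (\<theta> - \<theta>')"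
proof -
  let ?P = "\<lambda>i C. \<forall>\<theta>\<in>Theta M. \<forall>\<theta>'\<in>Theta M. \<bar>\<phi> i \<theta> - \<phi> i \<theta>'\<bar> \<le> C * norm (\<theta> - \<theta>')"
  have mono: "?P i C'" if "?P i C" "C \<le> C'" for i C C'
    using that by (meson mult_right_mono norm_ge_zero order_trans)
  have ex: "\<exists>C. ?P i C" if "i \<in> I" for i
    by (rule C2_on_lipschitz[OF assms(2)[OF that] Theta_subset_nbhd compact_Theta convex_Theta])
  have "\<exists>C\<ge>0. \<forall>i\<in>I. ?P i C"
    by (rule uniform_constant[of I ?P, OF assms(1)]) (erule ex, erule mono, assumption)
  then obtain C where C: "C \<ge> 0" "\<forall>i\<in>I. ?P i C" by (elim exE conjE)
  show ?thesis
  proof (rule that)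
    show "C * sqrt (real CARD('n)) \<ge> 0" using C(1) by simp
    fix i \<theta> \<theta>' assume *: "i \<in> I" "\<theta> \<in> Theta M" "\<theta>' \<in> Theta M"
    then have "\<bar>\<phi> i \<theta> - \<phi> i \<theta>'\<bar> \<le> C * norm (\<theta> - \<theta>')" using C(2) by blast
    also have "\<dots> \<le> C * (sqrt (real CARD('n)) * infnorm (\<theta> - \<theta>'))"
      by (intro mult_left_mono norm_le_sqrt_infnorm C(1))
    finally show "\<bar>\<phi> i \<theta> - \<phi> i \<theta>'\<bar> \<le> C * sqrt (real CARD('n)) * infnorm (\<theta> - \<theta>')"
      by (simp add: mult.assoc)
  qed
qed

lemma J_sel_lipschitz:
  obtains C where "C \<ge> 0"
    "\<And>\<sigma> \<theta> \<theta>'. \<sigma> \<in> selections M \<Longrightarrow> \<theta> \<in> Theta M \<Longrightarrow> \<theta>' \<in> Theta M \<Longrightarrow>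
      \<bar>J_sel M \<sigma> \<theta> - J_sel M \<sigma> \<theta>'\<bar> \<le> C * infnorm (\<theta> - \<theta>')"
  using uniform_lipschitz[of _ "J_sel M", OF finite_selections J_sel_C2] by metis

text \<open>The gap contains robust values and need not be smooth, but minima of finitely many
  Lipschitz functions are Lipschitz with the same constant.\<close>

lemma gap_lipschitz:
  "\<exists>C. \<forall>\<sigma>\<in>selections M. \<forall>(t, x, a)\<in>triples M. \<forall>\<theta>\<in>Theta M. \<forall>\<theta>'\<in>Theta M.
     \<bar>gap M \<sigma> \<theta> t x a - gap M \<sigma> \<theta>' t x a\<bar> \<le> C * infnorm (\<theta> - \<theta>')"
proof -
  let ?I = "selections M \<times> {..horizon M} \<times> states M" and ?K = "selections M \<times> triples M"
  have "finite ?I" using finite_selections finite_states by simp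
  moreover have "C2_on nbhd (\<lambda>\<theta>. V_sel M (fst i) \<theta> (fst (snd i)) (snd (snd i)))" if "i \<in> ?I" for i
    using that by (intro V_sel_C2) auto
  ultimately obtain C where "C \<ge> 0" and C: "\<And>i \<theta> \<theta>'. i \<in> ?I \<Longrightarrow> \<theta> \<in> Theta M \<Longrightarrow> \<theta>' \<in> Theta M \<Longrightarrow>
      \<bar>V_sel M (fst i) \<theta> (fst (snd i)) (snd (snd i)) - V_sel M (fst i) \<theta>' (fst (snd i)) (snd (snd i))\<bar>
        \<le> C * infnorm (\<theta> - \<theta>')"
    using uniform_lipschitz[of ?I "\<lambda>i \<theta>. V_sel M (fst i) \<theta> (fst (snd i)) (snd (snd i))"] by metis
  have V: "\<bar>V_rob M \<theta> t x - V_rob M \<theta>' t x\<bar> \<le> C * infnorm (\<theta> - \<theta>')"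
    if "\<theta> \<in> Theta M" "\<theta>' \<in> Theta M" "t \<le> horizon M" "x \<in> states M" for \<theta> \<theta>' t x
    unfolding V_rob_eq_Min[OF that(1,3,4)] V_rob_eq_Min[OF that(2,3,4)]
    using C[of "(_, t, x)" \<theta> \<theta>'] that
    by (intro abs_Min_diff_le finite_selections selections_nonempty) auto
  have "finite ?K" using finite_selections finite_triples by simp
  moreover have "C2_on nbhd (\<lambda>\<theta>. Q_sel M (fst k) \<theta> (fst (snd k)) (fst (snd (snd k))) (snd (snd (snd k))))"
    if "k \<in> ?K" for k
    using that by (intro Q_sel_C2) (auto simp: triples_def)
  ultimately obtain C' where C': "\<And>k \<theta> \<theta>'. k \<in> ?K \<Longrightarrow> \<theta> \<in> Theta M \<Longrightarrow> \<theta>' \<in> Theta M \<Longrightarrow>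
      \<bar>Q_sel M (fst k) \<theta> (fst (snd k)) (fst (snd (snd k))) (snd (snd (snd k)))
        - Q_sel M (fst k) \<theta>' (fst (snd k)) (fst (snd (snd k))) (snd (snd (snd k)))\<bar>
        \<le> C' * infnorm (\<theta> - \<theta>')"
    using uniform_lipschitz[of ?K "\<lambda>k \<theta>. Q_sel M (fst k) \<theta> (fst (snd k)) (fst (snd (snd k))) (snd (snd (snd k)))"]
    by metis
  \<comment> \<open>\<open>C'\<close> controls \<open>G_rob\<close>; \<open>C\<close> controls the
    robust next value, and averaging against a law does not enlarge it.\<close>
  have "\<bar>gap M \<sigma> \<theta> t x a - gap M \<sigma> \<theta>' t x a\<bar> \<le> (C + C') * infnorm (\<theta> - \<theta>')"
    if \<sigma>: "\<sigma> \<in> selections M" and txa: "t < horizon M" "x \<in> states M" "a \<in> actions M"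
      and \<theta>: "\<theta> \<in> Theta M" "\<theta>' \<in> Theta M" for \<sigma> t x a \<theta> \<theta>'
  proof -
    let ?P = "\<sigma> (t, x, a)" and ?D = "infnorm (\<theta> - \<theta>')"
    have "(t, x, a) \<in> triples M" using txa by (simp add: triples_def)
    then have "\<bar>G_rob M \<theta> t x a - G_rob M \<theta>' t x a\<bar> \<le> C' * ?D"
      unfolding G_rob_eq_Min[OF \<theta>(1) txa] G_rob_eq_Min[OF \<theta>(2) txa]
      using C'[of "(_, t, x, a)" \<theta> \<theta>'] \<theta>
      by (intro abs_Min_diff_le finite_selections selections_nonempty) auto
    moreover have "\<bar>step_value M t x a ?P (V_rob M \<theta> (Suc t)) - step_value M t x a ?P (V_rob M \<theta>' (Suc t))\<bar>
        \<le> (\<Sum>y\<in>states M. pmf ?P y * (C * ?D))"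
      unfolding step_value_diff
      using V[OF \<theta>] txa(1) by (intro order_trans[OF sum_abs] sum_mono) (auto simp: abs_mult intro!: mult_left_mono)
    moreover have "(\<Sum>y\<in>states M. pmf ?P y * (C * ?D)) = C * ?D"
      using selection_support[OF \<sigma> txa]
      by (simp add: sum_distrib_right[symmetric] sum_pmf_eq_1 finite_states)
    ultimately show ?thesis unfolding gap_def by (simp add: distrib_right)
  qed
  then show ?thesis by (intro exI[of _ "C + C'"]) (auto simp: triples_def)
qed

lemma J_sel_taylor:
  "\<exists>C. \<forall>\<sigma>\<in>selections M. \<forall>\<theta> r h. infnorm r \<le> 1 \<longrightarrow> \<theta> \<in> Theta M \<longrightarrow> \<theta> + h *\<^sub>R r \<in> Theta M \<longrightarrow>
     \<bar>J_sel M \<sigma> (\<theta> + h *\<^sub>R r) - J_sel M \<sigma> \<theta> - h * (grad (J_sel M \<sigma>) \<theta> \<bullet> r)\<bar> \<le> C * h\<^sup>2"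
proof -
  let ?P = "\<lambda>\<sigma> C. \<forall>\<theta>\<in>Theta M. \<forall>\<eta>. \<theta> + \<eta> \<in> Theta M \<longrightarrow>
    \<bar>J_sel M \<sigma> (\<theta> + \<eta>) - J_sel M \<sigma> \<theta> - grad (J_sel M \<sigma>) \<theta> \<bullet> \<eta>\<bar> \<le> C * (norm \<eta>)\<^sup>2"
  have mono: "?P i C'" if "?P i C" "C \<le> C'" for i C C'
    using that by (meson mult_right_mono zero_le_power2 order_trans)
  have ex: "\<exists>C. ?P \<sigma> C" for \<sigma>
    by (rule C2_on_taylor[OF J_sel_C2 Theta_subset_nbhd compact_Theta convex_Theta])
  have "\<exists>C\<ge>0. \<forall>\<sigma>\<in>selections M. ?P \<sigma> C"
    by (rule uniform_constant[of _ ?P, OF finite_selections]) (rule ex, erule mono, assumption)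
  then obtain C where C: "C \<ge> 0" "\<forall>\<sigma>\<in>selections M. ?P \<sigma> C" by (elim exE conjE)
  \<comment> \<open>For the increment \<open>h *\<^sub>R r\<close> the squared norm is
    \<open>h\<^sup>2 * (norm r)\<^sup>2\<close>, and the squared Euclidean norm of \<open>r\<close>
    is at most the dimension because its sup norm is at most 1.\<close>
  have "\<bar>J_sel M \<sigma> (\<theta> + h *\<^sub>R r) - J_sel M \<sigma> \<theta> - h * (grad (J_sel M \<sigma>) \<theta> \<bullet> r)\<bar> \<le> C * real CARD('n) * h\<^sup>2"
    if "\<sigma> \<in> selections M" "infnorm r \<le> 1" "\<theta> \<in> Theta M" "\<theta> + h *\<^sub>R r \<in> Theta M" for \<sigma> \<theta> r h
  proof -
    have "norm r \<le> sqrt (real CARD('n)) * infnorm r" by (rule norm_le_sqrt_infnorm)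
    also have "\<dots> \<le> sqrt (real CARD('n))" using that(2) by (simp add: mult_left_le)
    finally have "(norm r)\<^sup>2 \<le> real CARD('n)" by (simp add: sqrt_ge_absD)
    then have "C * (h\<^sup>2 * (norm r)\<^sup>2) \<le> C * (h\<^sup>2 * real CARD('n))"
      using C(1) by (intro mult_left_mono) auto
    moreover have "\<bar>J_sel M \<sigma> (\<theta> + h *\<^sub>R r) - J_sel M \<sigma> \<theta> - h * (grad (J_sel M \<sigma>) \<theta> \<bullet> r)\<bar>
        \<le> C * (h\<^sup>2 * (norm r)\<^sup>2)"
      using C(2)[rule_format, OF that(1,3,4)] by (simp add: power_mult_distrib)
    ultimately show ?thesis by (simp add: mult_ac)
  qed
  then show ?thesis by blast
qed

lemma lipschitz_and_taylor_constants:
  "\<exists>C0 C1 C2 :: real.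
    (\<forall>\<theta>\<in>Theta M. \<forall>\<theta>'\<in>Theta M.
       (\<forall>\<sigma>\<in>selections M. \<bar>J_sel M \<sigma> \<theta> - J_sel M \<sigma> \<theta>'\<bar> \<le> C0 * infnorm (\<theta> - \<theta>')) \<and>
       \<bar>J_rob M \<theta> - J_rob M \<theta>'\<bar> \<le> C0 * infnorm (\<theta> - \<theta>')) \<and>
    (\<forall>\<sigma>\<in>selections M. \<forall>(t, x, a)\<in>triples M. \<forall>\<theta>\<in>Theta M. \<forall>\<theta>'\<in>Theta M.
       \<bar>gap M \<sigma> \<theta> t x a - gap M \<sigma> \<theta>' t x a\<bar> \<le> C1 * infnorm (\<theta> - \<theta>')) \<and>
    (\<forall>\<sigma>\<in>selections M. \<forall>\<theta> r h. infnorm r \<le> 1 \<longrightarrow> \<theta> \<in> Theta M \<longrightarrow> \<theta> + h *\<^sub>R r \<in> Theta M \<longrightarrow>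
       \<bar>J_sel M \<sigma> (\<theta> + h *\<^sub>R r) - J_sel M \<sigma> \<theta> - h * (grad (J_sel M \<sigma>) \<theta> \<bullet> r)\<bar> \<le> C2 * h\<^sup>2)"
proof -
  obtain C0 where C0: "\<And>\<sigma> \<theta> \<theta>'. \<sigma> \<in> selections M \<Longrightarrow> \<theta> \<in> Theta M \<Longrightarrow> \<theta>' \<in> Theta M \<Longrightarrow>
      \<bar>J_sel M \<sigma> \<theta> - J_sel M \<sigma> \<theta>'\<bar> \<le> C0 * infnorm (\<theta> - \<theta>')"
    using J_sel_lipschitz by metis
  have rob: "\<bar>J_rob M \<theta> - J_rob M \<theta>'\<bar> \<le> C0 * infnorm (\<theta> - \<theta>')"
    if "\<theta> \<in> Theta M" "\<theta>' \<in> Theta M" for \<theta> \<theta>'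
    unfolding J_rob_eq_Min[OF that(1)] J_rob_eq_Min[OF that(2)]
    using C0 that by (intro abs_Min_diff_le finite_selections selections_nonempty)
  obtain C1 where C1: "\<forall>\<sigma>\<in>selections M. \<forall>(t, x, a)\<in>triples M. \<forall>\<theta>\<in>Theta M. \<forall>\<theta>'\<in>Theta M.
      \<bar>gap M \<sigma> \<theta> t x a - gap M \<sigma> \<theta>' t x a\<bar> \<le> C1 * infnorm (\<theta> - \<theta>')"
    using gap_lipschitz by blast
  obtain C2 where C2: "\<forall>\<sigma>\<in>selections M. \<forall>\<theta> r h. infnorm r \<le> 1 \<longrightarrow> \<theta> \<in> Theta M \<longrightarrow> \<theta> + h *\<^sub>R r \<in> Theta M \<longrightarrow>
      \<bar>J_sel M \<sigma> (\<theta> + h *\<^sub>R r) - J_sel M \<sigma> \<theta> - h * (grad (J_sel M \<sigma>) \<theta> \<bullet> r)\<bar> \<le> C2 * h\<^sup>2"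
    using J_sel_taylor by blast
  show ?thesis
    using C0 rob by (intro exI[of _ C0] exI[of _ C1] exI[of _ C2] conjI C1 C2 ballI)
qed

end

theorem theorem3p3:
  fixes M :: "('d::finite, 'm::finite, 'n::finite) rmdp"
  assumes "robust_mdp M"
  shows
    \<comment> \<open>(i)\<close>
    "((\<forall>\<sigma>\<in>selections M. \<exists>U. open U \<and> Theta M \<subseteq> U \<and> C2_on U (J_sel M \<sigma>)) \<and>
      (\<forall>\<theta>\<in>Theta M. J_rob M \<theta> = Min ((\<lambda>\<sigma>. J_sel M \<sigma> \<theta>) ` selections M)) \<and>
      (\<forall>\<theta>\<in>Theta M. active_selections M 0 \<theta> \<noteq> {} \<and>
                     active_selections M 0 \<theta> \<subseteq> optimal_selections M \<theta>))
     \<and>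
     ((\<forall>\<theta>\<in>Theta M. \<forall>r. (\<forall>\<^sub>F h in at_right 0. \<theta> + h *\<^sub>R r \<in> Theta M) \<longrightarrow>
         ((\<lambda>h. (J_rob M (\<theta> + h *\<^sub>R r) - J_rob M \<theta>) / h) \<longlongrightarrow>
            Min ((\<lambda>\<sigma>. grad (J_sel M \<sigma>) \<theta> \<bullet> r) ` optimal_selections M \<theta>)) (at_right 0)) \<and>
      (\<forall>\<theta>\<in>Theta M. \<forall>r. (\<forall>\<^sub>F h in at 0. \<theta> + h *\<^sub>R r \<in> Theta M) \<longrightarrow>
         ((\<lambda>h. (J_rob M (\<theta> + h *\<^sub>R r) - J_rob M \<theta>) / h) \<longlongrightarrow>
            Max ((\<lambda>\<sigma>. grad (J_sel M \<sigma>) \<theta> \<bullet> r) ` optimal_selections M \<theta>)) (at_left 0)) \<and>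
      (\<forall>\<theta>\<in>Theta M. \<forall>\<sigma>\<in>selections M.
         grad (J_sel M \<sigma>) \<theta> =
           path_expectation M \<sigma> \<theta> (\<lambda>X \<alpha>. \<Sum>t<horizon M.
             Q_sel M \<sigma> \<theta> t (X t) (\<alpha> t) *\<^sub>R
               grad (\<lambda>\<theta>'. ln (pmf (policy M t \<theta>' (X t)) (\<alpha> t))) \<theta>)))
     \<and>
     ((\<forall>\<sigma>\<in>selections M. \<forall>\<theta>\<in>Theta M.
         J_sel M \<sigma> \<theta> - J_rob M \<theta> =
           path_expectation M \<sigma> \<theta> (\<lambda>X \<alpha>. \<Sum>t<horizon M. gap M \<sigma> \<theta> t (X t) (\<alpha> t))) \<and>
      (\<forall>\<theta>\<in>Theta M. \<forall>\<zeta>\<ge>0. \<forall>\<sigma>\<in>active_selections M \<zeta> \<theta>.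
         J_sel M \<sigma> \<theta> \<le> J_rob M \<theta> + real (horizon M) * \<zeta>))
     \<and>
     (\<exists>C0 C1 C2 :: real.
        (\<forall>\<theta>\<in>Theta M. \<forall>\<theta>'\<in>Theta M.
           (\<forall>\<sigma>\<in>selections M. \<bar>J_sel M \<sigma> \<theta> - J_sel M \<sigma> \<theta>'\<bar> \<le> C0 * infnorm (\<theta> - \<theta>')) \<and>
           \<bar>J_rob M \<theta> - J_rob M \<theta>'\<bar> \<le> C0 * infnorm (\<theta> - \<theta>')) \<and>
        (\<forall>\<sigma>\<in>selections M. \<forall>(t, x, a)\<in>triples M. \<forall>\<theta>\<in>Theta M. \<forall>\<theta>'\<in>Theta M.
           \<bar>gap M \<sigma> \<theta> t x a - gap M \<sigma> \<theta>' t x a\<bar> \<le> C1 * infnorm (\<theta> - \<theta>')) \<and>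
        (\<forall>\<sigma>\<in>selections M. \<forall>\<theta> r h. infnorm r \<le> 1 \<longrightarrow> \<theta> \<in> Theta M \<longrightarrow> \<theta> + h *\<^sub>R r \<in> Theta M \<longrightarrow>
           \<bar>J_sel M \<sigma> (\<theta> + h *\<^sub>R r) - J_sel M \<sigma> \<theta> - h * (grad (J_sel M \<sigma>) \<theta> \<bullet> r)\<bar> \<le> C2 * h\<^sup>2))"
proof -
  interpret robust_mdp M by fact
  show ?thesis
    apply (intro conjI ballI allI impI)
    subgoal using open_nbhd Theta_subset_nbhd J_sel_C2 by blast
    subgoal by (rule J_rob_eq_Min)
    subgoal by (rule active_selection_exists)
    subgoal by (rule active_subset_optimal)
    subgoal by (rule J_rob_right_derivative)
    subgoal by (rule J_rob_left_derivative) (auto simp: eventually_at_split)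
    subgoal by (rule policy_gradient)
    subgoal by (rule performance_difference)
    subgoal by (rule J_sel_le_active)
    subgoal by (rule lipschitz_and_taylor_constants)
    done
qed

end
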